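(* Let $g_\alpha$, $\alpha\ge1$, be a family of functions satisfying the scaled-logarithmic-derivative assumption (A) of the context, with scaling function $\gamma$ and limit function $\psi$. For each $\alpha\ge 1$ let $(X_\alpha,Y_\alpha)$ be a random vector with distribution $\mu_{g_\alpha}$ (the permuton arising from $g_\alpha$), and define $$\mathcal{U}_\alpha:=\frac{X_\alpha+Y_\alpha}{2},\qquad \mathcal{V}_\alpha:=\gamma(\alpha)\cdot\frac{X_\alpha-Y_\alpha}{2}.$$ Then $$(\mathcal{U}_\alpha,\mathcal{V}_\alpha)\Longrightarrow\Big(U,\frac{1}{\psi(U)}\cdot L\Big)\qquad\text{as }\alpha\to\infty,$$ where $\Longrightarrow$ denotes convergence in distribution, $U$ is uniformly distributed on $[0,1]$, $L$ is independent of $U$, and $L$ has probability density function $\frac{2}{(e^t+e^{-t})^2}$, $t\in\mathbb{R}$.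
   Context: **Permuton arising from $g$.** A permuton is a probability measure on $[0,1]^2$ both of whose marginals are uniform on $[0,1]$. Let $g:[0,1]\to\mathbb{R}$ be a strictly decreasing $C^1$ function with $g(0)=1$, $g(1)=0$. Let $u(x)=\int_0^x\frac{1}{g(z)}\,dz$ for $x\in[0,1)$ (one has $u(x)\to+\infty$ as $x\to1_-$), and define $V_g(x,y)=u^{-1}(u(x)+u(y))$ for $(x,y)\in[0,1)^2$, extended to $[0,1]^2$ by $V_g(1,y)=V_g(x,1)=1$. Then $F_g(x,y)=x+y-V_g(x,y)$ is the joint c.d.f. of a permuton, denoted $\mu_g$. **Assumption (A).** For each $\alpha\ge1$, $g_\alpha:[0,1]\to\mathbb{R}$ is a strictly decreasing $C^1$ function with $g_\alpha(0)=1$, $g_\alpha(1)=0$. Let $\gamma:[1,\infty)\to(0,\infty)$, let $\psi:[0,1)\to\mathbb{R}$, and for $\alpha\ge 1$ put $$\psi_\alpha(s)=-\frac{1}{\gamma(\alpha)}\cdot\frac{g_\alpha'(s)}{g_\alpha(s)},\qquad s\in[0,1).$$ It is assumed that: (i) $\lim_{\alpha\to\infty}\gamma(\alpha)=+\infty$; (ii) the family $\psi_\alpha$, $\alpha\ge1$, is uniformly equicontinuous on each compact subinterval of $[0,1)$; (iii) $\psi_\alpha\to\psi$ uniformly on each compact subinterval of $[0,1)$ as $\alpha\to\infty$; (iv) $\psi(s)>0$ for all $s\in[0,1)$. *)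

theory Defs
  imports "HOL-Probability.Probability"
begin

section \<open>Permutons\<close>

text \<open>A measure on the unit square is represented as a Borel measure on the plane that is
  concentrated on the square.\<close>

definition permuton :: "(real \<times> real) measure \<Rightarrow> bool" where
  "permuton P \<longleftrightarrow> prob_space P \<and> sets P = sets borel
     \<and> measure P ({0..1} \<times> {0..1}) = 1
     \<and> distr P lborel fst = uniform_measure lborel {0..1}
     \<and> distr P lborel snd = uniform_measure lborel {0..1}"

section \<open>The permuton arising from a decreasing function\<close>

text \<open>Derivative on the unit interval, one-sided at the end points. The library's
  \<^term>\<open>deriv\<close> and \<open>C1_differentiable_on\<close> are not used because they refer to the two-sided
  derivative and so to the (meaningless) values of the function outside the interval.\<close>

definition deriv01 :: "(real \<Rightarrow> real) \<Rightarrow> real \<Rightarrow> real" where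
  "deriv01 g s = vector_derivative g (at s within {0..1})"

definition admissible :: "(real \<Rightarrow> real) \<Rightarrow> bool" where
  "admissible g \<longleftrightarrow> strict_antimono_on {0..1} g
     \<and> g differentiable_on {0..1} \<and> continuous_on {0..1} (deriv01 g)
     \<and> g 0 = 1 \<and> g 1 = 0"

definition u_fun :: "(real \<Rightarrow> real) \<Rightarrow> real \<Rightarrow> real" where
  "u_fun g x = integral {0..x} (\<lambda>z. 1 / g z)"

definition V_fun :: "(real \<Rightarrow> real) \<Rightarrow> real \<Rightarrow> real \<Rightarrow> real" where
  "V_fun g x y = (if x = 1 \<or> y = 1 then 1
     else inv_into {0..<1} (u_fun g) (u_fun g x + u_fun g y))"

definition F_fun :: "(real \<Rightarrow> real) \<Rightarrow> real \<Rightarrow> real \<Rightarrow> real" where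
  "F_fun g x y = x + y - V_fun g x y"

text \<open>For admissible \<open>g\<close> there is exactly one permuton whose joint c.d.f. on the unit square is
  \<^term>\<open>F_fun g\<close>; for other \<open>g\<close> the value is irrelevant.\<close>

definition permuton_of :: "(real \<Rightarrow> real) \<Rightarrow> (real \<times> real) measure" where
  "permuton_of g = (THE P. permuton P \<and>
     (\<forall>x\<in>{0..1}. \<forall>y\<in>{0..1}. measure P ({..x} \<times> {..y}) = F_fun g x y))"

section \<open>Scaled logarithmic derivatives\<close>

definition psi_scaled :: "(real \<Rightarrow> real \<Rightarrow> real) \<Rightarrow> (real \<Rightarrow> real) \<Rightarrow> real \<Rightarrow> real \<Rightarrow> real" where
  "psi_scaled g \<gamma> \<alpha> s = - (1 / \<gamma> \<alpha>) * (deriv01 (g \<alpha>) s / g \<alpha> s)"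

text \<open>Only the values of \<open>g\<close> and \<open>\<gamma>\<close> at parameters \<open>\<alpha> \<ge> 1\<close>, of \<open>g \<alpha>\<close> on \<open>[0,1]\<close> and of \<open>\<psi>\<close>
  on \<open>[0,1)\<close> are constrained.\<close>

definition scaled_log_deriv_assumption ::
  "(real \<Rightarrow> real \<Rightarrow> real) \<Rightarrow> (real \<Rightarrow> real) \<Rightarrow> (real \<Rightarrow> real) \<Rightarrow> bool" where
  "scaled_log_deriv_assumption g \<gamma> \<psi> \<longleftrightarrow>
     (\<forall>\<alpha>\<ge>1. admissible (g \<alpha>)) \<and>
     (\<forall>\<alpha>\<ge>1. \<gamma> \<alpha> > 0) \<and>
     filterlim \<gamma> at_top at_top \<and>
     (\<forall>a b. 0 \<le> a \<and> a \<le> b \<and> b < 1 \<longrightarrow>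
        (\<forall>\<epsilon>>0. \<exists>\<delta>>0. \<forall>\<alpha>\<ge>1. \<forall>s\<in>{a..b}. \<forall>t\<in>{a..b}.
           \<bar>s - t\<bar> < \<delta> \<longrightarrow> \<bar>psi_scaled g \<gamma> \<alpha> s - psi_scaled g \<gamma> \<alpha> t\<bar> < \<epsilon>)) \<and>
     (\<forall>a b. 0 \<le> a \<and> a \<le> b \<and> b < 1 \<longrightarrow>
        uniform_limit {a..b} (psi_scaled g \<gamma>) \<psi> at_top) \<and>
     (\<forall>s\<in>{0..<1}. \<psi> s > 0)"

section \<open>Convergence in distribution\<close>

text \<open>The library's \<^const>\<open>weak_conv_m\<close> only covers sequences of measures on the real line; this
  is weak convergence along an arbitrary filter, for Borel probability measures on an arbitrary
  topological space, by bounded continuous test functions.\<close>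

definition weakly_converges ::
  "('i \<Rightarrow> 'a::topological_space measure) \<Rightarrow> 'a measure \<Rightarrow> 'i filter \<Rightarrow> bool" where
  "weakly_converges \<mu> \<nu> F \<longleftrightarrow>
     (\<forall>f :: 'a \<Rightarrow> real. continuous_on UNIV f \<and> bounded (range f) \<longrightarrow>
        ((\<lambda>i. integral\<^sup>L (\<mu> i) f) \<longlongrightarrow> integral\<^sup>L \<nu> f) F)"

text \<open>The function \<open>\<psi>\<close> is only given on \<open>[0,1)\<close>. A random variable that is uniform on \<open>[0,1]\<close>
  leaves \<open>[0,1)\<close> with probability zero, and the value on that event is set to \<open>0\<close>; using the
  unconstrained values of \<open>\<psi>\<close> there could destroy measurability.\<close>

definition scaled_by_inverse :: "(real \<Rightarrow> real) \<Rightarrow> real \<Rightarrow> real \<Rightarrow> real" where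
  "scaled_by_inverse \<psi> u l = (if u \<in> {0..<1} then 1 / \<psi> u * l else 0)"

end

theory Submission
  imports Defs
begin

text \<open>For admissible \<open>g\<close>, the permuton has the density \<open>- g'(V) g(V) / (g(x) g(y))\<close> on the unit
  square, where \<open>V = V_g(x,y)\<close>: this is the mixed derivative of \<open>x + y - V\<close>, because \<open>u' = 1/g\<close>.
  Hence \<open>((X + Y)/2, \<gamma> (X - Y)/2)\<close> has at \<open>(p, v)\<close> the density
  \<open>2 \<psi>\<^sub>\<alpha>(V) g(V)\<^sup>2 / (g(x) g(y))\<close> with \<open>x = p + v/\<gamma>\<close> and \<open>y = p - v/\<gamma>\<close>. Locally \<open>g\<close> decays like
  \<open>exp (- \<gamma> \<psi>(p) s)\<close>, so \<open>\<gamma> u g\<close> tends to \<open>1/\<psi>(p)\<close> near \<open>p\<close>, and \<open>u(V) = u(x) + u(y)\<close> turns into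
  \<open>1/g(V) \<approx> 1/g(x) + 1/g(y)\<close>. Together with \<open>g(x)/g(y) \<longlonglongrightarrow> exp (- 2 \<psi>(p) v)\<close> this gives the pointwise
  limit of the densities, which is the density of \<open>(U, L/\<psi>(U))\<close>, and pointwise convergence of
  probability densities implies weak convergence.\<close>

section \<open>The function \<open>u\<close> and its inverse\<close>

text \<open>The assumption controls \<open>\<psi>\<^sub>\<alpha>\<close> only on compact
  subintervals of [0,1), so limits are taken at a fixed p in (0,1) and along points tending to p.
  Nothing is estimated near the edges of the square. What prevents mass from escaping there is that
  every density involved has integral 1, which is why the permuton is first shown to be absolutely
  continuous with full mass. \<open>permuton_of\<close> is a definite description, so the density
  has to be justified twice: its measure must have the right c.d.f. and marginals, and no other
  permuton may share that c.d.f. The point V is given only implicitly through \<open>u\<close>, and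
  the asymptotics of \<gamma> u g can be used at V only once V is known to tend to p. This needs an
  argument of its own, resting on the exponential decay of \<open>g\<close> to the right of p. In
  the limit the values 1/\<psi>(p) of \<gamma> u g at x, y and V cancel. What remains is the product
  of 1 + exp (- 2 \<psi>(p) v) and 1 + exp (2 \<psi>(p) v), which is the origin of the density of
  L.\<close>

locale admissible_function =
  fixes g :: "real \<Rightarrow> real"
  assumes admissible: "admissible g"
begin

abbreviation g' :: "real \<Rightarrow> real" where "g' \<equiv> deriv01 g"
abbreviation u :: "real \<Rightarrow> real" where "u \<equiv> u_fun g"
abbreviation V :: "real \<Rightarrow> real \<Rightarrow> real" where "V \<equiv> V_fun g"

section \<open>Monotonicity, positivity and differentiability of \<open>g\<close>\<close>

lemma g_0: "g 0 = 1" and g_1: "g 1 = 0"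
  using admissible by (auto simp: admissible_def)

lemma g_less: "0 \<le> x \<Longrightarrow> x < y \<Longrightarrow> y \<le> 1 \<Longrightarrow> g y < g x"
  using admissible by (auto simp: admissible_def monotone_on_def)

lemma g_le: "0 \<le> x \<Longrightarrow> x \<le> y \<Longrightarrow> y \<le> 1 \<Longrightarrow> g y \<le> g x"
  using g_less[of x y] by (cases "x = y") auto

lemma g_pos: "0 \<le> x \<Longrightarrow> x < 1 \<Longrightarrow> g x > 0"
  using g_less[of x 1] g_1 by auto

lemma g_nonneg: "0 \<le> x \<Longrightarrow> x \<le> 1 \<Longrightarrow> g x \<ge> 0"
  using g_le[of x 1] g_1 by auto

lemma continuous_on_g: "continuous_on {0..1} g"
  using admissible by (auto simp: admissible_def intro: differentiable_imp_continuous_on)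

lemma continuous_on_g': "continuous_on {0..1} g'"
  using admissible by (auto simp: admissible_def)

lemma isCont_g: "0 < x \<Longrightarrow> x < 1 \<Longrightarrow> isCont g x"
  using continuous_on_interior[OF continuous_on_g, of x] by (simp add: interior_atLeastAtMost_real)

lemma isCont_g': "0 < x \<Longrightarrow> x < 1 \<Longrightarrow> isCont g' x"
  using continuous_on_interior[OF continuous_on_g', of x] by (simp add: interior_atLeastAtMost_real)

lemma DERIV_g:
  assumes "0 < x" "x < 1"
  shows "(g has_real_derivative g' x) (at x)"
proof -
  have "g differentiable (at x within {0..1})"
    using admissible assms by (auto simp: admissible_def differentiable_on_def)
  then have "(g has_vector_derivative g' x) (at x within {0..1})"
    unfolding deriv01_def by (simp add: vector_derivative_works)
  then show ?thesis
    using assms by (simp add: has_real_derivative_iff_has_vector_derivative at_within_Icc_at)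
qed

lemma g'_nonpos:
  assumes "0 < x" "x < 1"
  shows "g' x \<le> 0"
proof (rule ccontr)
  assume "\<not> g' x \<le> 0"
  then obtain d where d: "0 < d" "\<forall>h>0. h < d \<longrightarrow> g x < g (x + h)"
    using DERIV_pos_inc_right[OF DERIV_g[OF assms]] by force
  define h where "h = min (d / 2) ((1 - x) / 2)"
  have "0 < h" "h < d" "x + h \<le> 1"
    using d(1) assms by (auto simp: h_def min_def field_simps)
  then show False
    using d(2) g_less[of x "x + h"] assms by fastforce
qed

section \<open>The integral \<open>u\<close> of 1/g\<close>

lemma continuous_on_inverse_g: "b < 1 \<Longrightarrow> continuous_on {0..b} (\<lambda>z. 1 / g z)"
  by (intro continuous_intros continuous_on_subset[OF continuous_on_g])
     (use g_pos in force)+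

lemma inverse_g_integrable: "0 \<le> a \<Longrightarrow> b < 1 \<Longrightarrow> (\<lambda>z. 1 / g z) integrable_on {a..b}"
  by (intro integrable_continuous_real continuous_on_subset[OF continuous_on_inverse_g[of b]]) auto

lemma u_0: "u 0 = 0"
  by (simp add: u_fun_def)

lemma u_diff: "0 \<le> a \<Longrightarrow> a \<le> b \<Longrightarrow> b < 1 \<Longrightarrow> u b - u a = integral {a..b} (\<lambda>z. 1 / g z)"
  unfolding u_fun_def
  using Henstock_Kurzweil_Integration.integral_combine[of 0 a b "\<lambda>z. 1 / g z"] inverse_g_integrable[of 0 b] by simp

lemma DERIV_u_within:
  assumes "0 \<le> x" "x < b" "b < 1"
  shows "(u has_real_derivative 1 / g x) (at x within {0..b})"
  using integral_has_vector_derivative[OF continuous_on_inverse_g[OF assms(3)], of x] assms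
  by (simp add: has_real_derivative_iff_has_vector_derivative u_fun_def[abs_def])

lemma DERIV_u:
  assumes "0 < x" "x < 1"
  shows "(u has_real_derivative 1 / g x) (at x)"
proof -
  define b where "b = (x + 1) / 2"
  have b: "x < b" "b < 1" using assms by (auto simp: b_def)
  show ?thesis
    using DERIV_u_within[of x b] assms b by (simp add: at_within_Icc_at)
qed

lemma isCont_u: "0 < x \<Longrightarrow> x < 1 \<Longrightarrow> isCont u x"
  using DERIV_u DERIV_isCont by blast

lemma continuous_on_u: 
  assumes "b < 1" shows "continuous_on {0..b} u"
proof -
  \<comment> \<open>\<open>DERIV_u_within\<close> excludes the right end of its interval, so
    continuity at \<open>b\<close> itself is taken from the larger interval
    \<open>{0..c}\<close>.\<close>
  define c where "c = (b + 1) / 2"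
  have c: "b < c" "c < 1" using assms by (auto simp: c_def)
  have "continuous (at x within {0..c}) u" if "x \<in> {0..b}" for x
    using DERIV_u_within[of x c] that c by (intro DERIV_continuous) auto
  then show ?thesis
    using c by (auto simp: continuous_on_def continuous_within intro: tendsto_within_subset[where S = "{0..c}"])
qed

text \<open>As \<open>g\<close> decreases, 1/g on \<open>{a..b}\<close> lies between its end values.
  These rectangle bounds give strict monotonicity of \<open>u\<close> and, later, a comparison of
  \<open>u\<close> with 1/g that is crude but good enough against exponential decay.\<close>

lemma u_diff_bounds:
  assumes "0 \<le> a" "a \<le> b" "b < 1"
  shows "(b - a) / g a \<le> u b - u a" "u b - u a \<le> (b - a) / g b"
proof -
  have c: "((\<lambda>z. c) has_integral (b - a) * c) {a..b}" for c :: real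
    using has_integral_const_real[of c a b] assms by simp
  have i: "((\<lambda>z. 1 / g z) has_integral (u b - u a)) {a..b}"
    unfolding u_diff[OF assms] using inverse_g_integrable assms by (intro integrable_integral) auto
  have "(b - a) * (1 / g a) \<le> u b - u a"
    by (rule has_integral_le[OF c i]) (use assms g_le g_pos in \<open>force intro!: divide_left_mono mult_pos_pos\<close>)
  then show "(b - a) / g a \<le> u b - u a" by simp
  have "u b - u a \<le> (b - a) * (1 / g b)"
    by (rule has_integral_le[OF i c]) (use assms g_le g_pos in \<open>force intro!: divide_left_mono mult_pos_pos\<close>)
  then show "u b - u a \<le> (b - a) / g b" by simp
qed

lemma u_less: 
  assumes "0 \<le> a" "a < b" "b < 1"
  shows "u a < u b"
proof -
  have "0 < (b - a) / g a" using assms g_pos[of a] by simp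
  then show ?thesis using u_diff_bounds(1)[of a b] assms by linarith
qed

lemma u_le: "0 \<le> a \<Longrightarrow> a \<le> b \<Longrightarrow> b < 1 \<Longrightarrow> u a \<le> u b"
  using u_less[of a b] by (cases "a = b") auto

lemma u_le_iff: "0 \<le> a \<Longrightarrow> a < 1 \<Longrightarrow> 0 \<le> b \<Longrightarrow> b < 1 \<Longrightarrow> u a \<le> u b \<longleftrightarrow> a \<le> b"
  using u_less[of b a] u_le[of a b] by (cases "a \<le> b") auto

lemma u_nonneg: "0 \<le> a \<Longrightarrow> a < 1 \<Longrightarrow> 0 \<le> u a"
  using u_le[of 0 a] u_0 by simp

lemma u_pos: "0 < a \<Longrightarrow> a < 1 \<Longrightarrow> 0 < u a"
  using u_less[of 0 a] u_0 by simp

lemma inj_on_u: "inj_on u {0..<1}"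
proof (rule inj_onI)
  fix x y assume "x \<in> {0..<1}" "y \<in> {0..<1}" "u x = u y"
  then show "x = y"
    using u_less[of x y] u_less[of y x] by (cases x y rule: linorder_cases) auto
qed

text \<open>If \<open>\<bar>g'\<bar> \<le> C\<close>, then \<open>ln g + C u\<close> is increasing, so \<open>u\<close> blows up where \<open>g\<close> vanishes.\<close>

lemma u_unbounded: "\<exists>x. 0 \<le> x \<and> x < 1 \<and> A \<le> u x"
proof -
  obtain C where C: "\<And>x. x \<in> {0..1} \<Longrightarrow> \<bar>g' x\<bar> \<le> C" "C > 0"
  proof -
    have "compact (g' ` {0..1})"
      by (intro compact_continuous_image continuous_on_g' compact_Icc)
    then obtain C where "C > 0" "\<forall>y\<in>g' ` {0..1}. norm y \<le> C"
      using bounded_pos[THEN iffD1, OF compact_imp_bounded] by blast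
    then show ?thesis using that[of C] by auto
  qed
  \<comment> \<open>Since \<open>ln (g 0)\<close> and \<open>u 0\<close> vanish, monotonicity of ln
    g + C u up to the point where \<open>g\<close> takes this value reads 0 \<le> - C |A| + C u. The
    absolute value keeps the level at most 1, within the range of \<open>g\<close>.\<close>
  define c where "c = exp (- (C * \<bar>A\<bar>))"
  have c: "0 < c" "c \<le> 1" using C(2) by (auto simp: c_def)
  obtain x where x: "0 \<le> x" "x \<le> 1" "g x = c"
    using IVT2'[of g 1 c 0] continuous_on_g c g_0 g_1 by auto
  have x1: "x < 1" using x g_1 c by (cases "x = 1") auto
  have "ln (g 0) + C * u 0 \<le> ln (g x) + C * u x"
  proof (rule DERIV_nonneg_imp_increasing_open[OF x(1)])
    fix y assume y: "0 < y" "y < x"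
    then have "g y > 0" using g_pos x1 by simp
    have "((\<lambda>x. ln (g x) + C * u x) has_real_derivative (g' y / g y + C * (1 / g y))) (at y)"
      using y x1 \<open>g y > 0\<close> by (auto intro!: derivative_eq_intros DERIV_g DERIV_u)
    moreover have "g' y / g y + C * (1 / g y) \<ge> 0"
      using C(1)[of y] y x1 \<open>g y > 0\<close> by (simp add: field_simps)
    ultimately show "\<exists>z. ((\<lambda>x. ln (g x) + C * u x) has_real_derivative z) (at y) \<and> 0 \<le> z" by blast
  next
    have "\<forall>z\<in>{0..x}. g z \<noteq> 0" using g_pos x1 by force
    then show "continuous_on {0..x} (\<lambda>a. ln (g a) + C * u a)"
      using x1 by (intro continuous_intros continuous_on_u continuous_on_subset[OF continuous_on_g]) auto
  qed
  then have "C * \<bar>A\<bar> \<le> C * u x" by (simp add: g_0 u_0 x(3) c_def)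
  then have "A \<le> u x" using C(2) by (simp add: abs_le_iff)
  then show ?thesis using x x1 by blast
qed

lemma u_surj:
  assumes "0 \<le> a"
  obtains x where "0 \<le> x" "x < 1" "u x = a"
proof -
  obtain b where b: "0 \<le> b" "b < 1" "a \<le> u b" using u_unbounded by blast
  obtain x where "0 \<le> x" "x \<le> b" "u x = a"
    using IVT'[of u 0 a b] continuous_on_u[OF b(2)] b assms u_0 by auto
  then show ?thesis using that b by auto
qed

section \<open>The inverse of \<open>u\<close>\<close>

definition w :: "real \<Rightarrow> real" where "w = inv_into {0..<1} u"

lemma w_bounds: "0 \<le> a \<Longrightarrow> 0 \<le> w a" "0 \<le> a \<Longrightarrow> w a < 1" and u_w: "0 \<le> a \<Longrightarrow> u (w a) = a"
proof -
  assume "0 \<le> a"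
  then obtain x where "0 \<le> x" "x < 1" "u x = a" by (rule u_surj)
  then have a: "a \<in> u ` {0..<1}" by auto
  show "0 \<le> w a" "w a < 1" "u (w a) = a"
    using inv_into_into[OF a] f_inv_into_f[OF a] by (auto simp: w_def)
qed

lemma w_u: "0 \<le> x \<Longrightarrow> x < 1 \<Longrightarrow> w (u x) = x"
  unfolding w_def by (intro inv_into_f_f inj_on_u) auto

lemma w_pos: "0 < a \<Longrightarrow> 0 < w a"
  using w_bounds[of a] u_w[of a] u_0 by (cases "w a = 0") auto

lemma isCont_w:
  assumes "0 < a"
  shows "isCont w a"
proof -
  have *: "0 < w a" "w a < 1" using assms w_pos w_bounds by auto
  \<comment> \<open>Half the distance from \<open>w a\<close> to the boundary: the closed ball of
    this radius stays in (0,1), where \<open>w\<close> inverts \<open>u\<close> and \<open>u\<close>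
    is continuous.\<close>
  define d where "d = min (w a) (1 - w a) / 2"
  have d: "0 < d" "d < w a" "d < 1 - w a" using * by (auto simp: d_def min_def)
  have "isCont w (u (w a))"
    by (rule isCont_inverse_function[of d])
       (use d in \<open>auto simp: abs_le_iff intro!: w_u isCont_u\<close>)
  then show ?thesis using u_w assms by simp
qed

text \<open>The inverse of a function with derivative 1/g solves the autonomous equation w' = g(w).
  This makes the partial derivatives of \<open>V\<close> expressible through \<open>g\<close> and
  \<open>V\<close> alone.\<close>

lemma DERIV_w:
  assumes "0 < a"
  shows "(w has_real_derivative g (w a)) (at a)"
proof -
  have *: "0 < w a" "w a < 1" using assms w_pos w_bounds by auto
  have "(w has_real_derivative inverse (1 / g (w a))) (at a)"
    by (rule DERIV_inverse_function[where f = u and g = w and x = a and a = 0 and b = "a + 1", OF DERIV_u[OF *]])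
       (use assms g_pos[of "w a"] * in \<open>auto intro: u_w isCont_w\<close>)
  then show ?thesis by simp
qed

section \<open>The operation \<open>V\<close> and its bounds\<close>

lemma V_eq: "x \<noteq> 1 \<Longrightarrow> y \<noteq> 1 \<Longrightarrow> V x y = w (u x + u y)"
  by (simp add: V_fun_def w_def)

lemma V_1: "V 1 y = 1" "V x 1 = 1"
  by (auto simp: V_fun_def)

lemma V_commute: "V x y = V y x"
  by (auto simp: V_fun_def add.commute)

lemma u_V: "0 \<le> x \<Longrightarrow> x < 1 \<Longrightarrow> 0 \<le> y \<Longrightarrow> y < 1 \<Longrightarrow> u (V x y) = u x + u y"
  using u_nonneg[of x] u_nonneg[of y] by (simp add: V_eq u_w)

lemma V_0: "0 \<le> x \<Longrightarrow> x \<le> 1 \<Longrightarrow> V x 0 = x"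
  by (cases "x = 1") (auto simp: V_1 V_eq u_0 w_u)

lemma V_less_1: "0 \<le> x \<Longrightarrow> x < 1 \<Longrightarrow> 0 \<le> y \<Longrightarrow> y < 1 \<Longrightarrow> V x y < 1"
  using w_bounds[of "u x + u y"] u_nonneg[of x] u_nonneg[of y] by (simp add: V_eq)

lemma V_ge:
  assumes "0 \<le> x" "x \<le> 1" "0 \<le> y" "y \<le> 1"
  shows "x \<le> V x y"
proof (cases "x = 1 \<or> y = 1")
  case False
  then have "u x \<le> u (V x y)" "0 \<le> V x y" "V x y < 1"
    using assms u_V[of x y] u_nonneg[of x] u_nonneg[of y] w_bounds[of "u x + u y"]
    by (auto simp: V_eq)
  then show ?thesis using u_le_iff[of x "V x y"] False assms by auto
qed (use assms V_1 in auto)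

lemma V_ge': "0 \<le> x \<Longrightarrow> x \<le> 1 \<Longrightarrow> 0 \<le> y \<Longrightarrow> y \<le> 1 \<Longrightarrow> y \<le> V x y"
  using V_ge[of y x] V_commute[of x y] by simp

text \<open>Because 1/g increases, an interval of length \<open>V x y - x\<close> collects no more
  of its integral when it starts at 0 than when it starts at \<open>x\<close>, and there it collects
  exactly \<open>u y\<close>. The bound makes \<open>F_fun\<close> nonnegative and controls
  \<open>V x s\<close> as s tends to 0.\<close>

lemma V_le:
  assumes "0 \<le> x" "x \<le> 1" "0 \<le> y" "y \<le> 1"
  shows "V x y \<le> x + y"
proof (cases "x = 1 \<or> y = 1")
  case False
  have V: "x \<le> V x y" "V x y < 1" using V_ge V_less_1[of x y] assms False by auto
  have "u (V x y - x) \<le> u (V x y) - u x"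
  proof -
    have "integral {0..V x y - x} (\<lambda>z. 1 / g z) \<le> integral {0..V x y - x} (\<lambda>z. 1 / g (z + x))"
    proof (rule integral_le)
      show "(\<lambda>z. 1 / g z) integrable_on {0..V x y - x}"
        using inverse_g_integrable[of 0 "V x y - x"] V assms by auto
      show "(\<lambda>z. 1 / g (z + x)) integrable_on {0..V x y - x}"
        using integrable_on_shift_Icc_real[of "\<lambda>z. 1 / g z" x 0 "V x y - x"] inverse_g_integrable[of x "V x y"] V assms by (simp add: o_def add.commute)
      show "1 / g z \<le> 1 / g (z + x)" if "z \<in> {0..V x y - x}" for z
        using that V assms g_pos[of "z + x"] g_le[of z "z + x"] g_pos[of z]
        by (intro divide_left_mono mult_pos_pos) auto
    qed
    also have "\<dots> = integral {x..V x y} (\<lambda>z. 1 / g z)"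
      using integral_shift_Icc_real[of 0 "V x y - x" "\<lambda>z. 1 / g z" x] by (simp add: o_def add.commute)
    also have "\<dots> = u (V x y) - u x"
      using u_diff V assms by simp
    finally show ?thesis by (simp add: u_fun_def)
  qed
  also have "\<dots> = u y" using u_V False assms by auto
  finally show ?thesis using u_le_iff[of "V x y - x" y] V assms False by auto
qed (use assms V_1 in auto)

end

section \<open>The density of the permuton\<close>

text \<open>Restricting to the open square loses only a null set; there \<open>g\<close> is positive
  and \<open>V\<close> lies in (0,1), where \<open>deriv01\<close> is a two-sided derivative. Scalar
  multiplication by the indicator is the shape in which continuity on a set yields
  measurability.\<close>

definition permuton_density :: "(real \<Rightarrow> real) \<Rightarrow> real \<times> real \<Rightarrow> real" where
  "permuton_density g p = indicator ({0<..<1} \<times> {0<..<1}) p *\<^sub>R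
     (- deriv01 g (V_fun g (fst p) (snd p)) * g (V_fun g (fst p) (snd p)) / (g (fst p) * g (snd p)))"

context admissible_function begin

text \<open>Chain rule with w' = g(w) and u' = 1/g. Both integrations of the density rest on it: one
  differentiates g(V), the other V itself.\<close>

lemma DERIV_V:
  assumes "0 < x" "x < 1" "0 < t" "t < 1"
  shows "(V x has_real_derivative g (V x t) / g t) (at t)"
proof -
  have "u x + u t > 0" using u_pos assms by (simp add: add_pos_pos)
  have "((\<lambda>t. w (u x + u t)) has_real_derivative g (w (u x + u t)) * (1 / g t)) (at t)"
    by (rule DERIV_chain2[OF DERIV_w]) (use assms \<open>u x + u t > 0\<close> in \<open>auto intro!: derivative_eq_intros DERIV_u\<close>)
  then have "(V x has_real_derivative g (w (u x + u t)) * (1 / g t)) (at t)"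
    by (rule has_field_derivative_transform_within_open[where S = "{0<..<1}"])
       (use assms in \<open>auto simp: V_eq\<close>)
  then show ?thesis using assms by (simp add: V_eq)
qed

lemma V_pos: "0 < x \<Longrightarrow> x \<le> 1 \<Longrightarrow> 0 \<le> y \<Longrightarrow> y \<le> 1 \<Longrightarrow> 0 < V x y"
  using V_ge[of x y] by simp

lemma V_le_1: "0 \<le> x \<Longrightarrow> x \<le> 1 \<Longrightarrow> 0 \<le> y \<Longrightarrow> y \<le> 1 \<Longrightarrow> V x y \<le> 1"
  using V_less_1[of x y] V_1 by (cases "x = 1 \<or> y = 1") auto

text \<open>The fundamental theorem of calculus needs the end points as well, where
  \<open>DERIV_V\<close> says nothing. There \<open>V\<close> is squeezed: x \<le> V x s \<le> x + s
  near 0 and s \<le> V x s \<le> 1 near 1.\<close>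

lemma continuous_on_V:
  assumes "0 < x" "x < 1"
  shows "continuous_on {0..1} (V x)"
proof (clarsimp simp: continuous_on_def)
  fix t :: real assume t: "0 \<le> t" "t \<le> 1"
  consider "t = 0" | "t = 1" | "0 < t" "t < 1" using t by linarith
  then show "(V x \<longlongrightarrow> V x t) (at t within {0..1})"
  proof cases
    case 1
    have "((\<lambda>s. x + s) \<longlongrightarrow> x + 0) (at 0 within {0..1})"
      by (intro tendsto_intros)
    moreover have "\<forall>\<^sub>F s in at 0 within {0..1}. x \<le> V x s \<and> V x s \<le> x + s"
      using assms by (simp add: eventually_at_filter V_ge V_le)
    ultimately have "(V x \<longlongrightarrow> x) (at 0 within {0..1})"
      unfolding eventually_conj_iff add_0_right
      by (elim conjE) (rule real_tendsto_sandwich[OF _ _ tendsto_const]; assumption)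
    then show ?thesis using 1 assms by (simp add: V_0)
  next
    case 2
    have "((\<lambda>s. s) \<longlongrightarrow> 1) (at (1::real) within {0..1})"
      by (intro tendsto_intros)
    moreover have "\<forall>\<^sub>F s in at 1 within {0..1}. s \<le> V x s \<and> V x s \<le> 1"
      using assms by (simp add: eventually_at_filter V_le_1 V_ge')
    ultimately have "(V x \<longlongrightarrow> 1) (at 1 within {0..1})"
      unfolding eventually_conj_iff
      by (elim conjE) (rule real_tendsto_sandwich[OF _ _ _ tendsto_const]; assumption)
    then show ?thesis using 2 by (simp add: V_1)
  next
    case 3
    then have "isCont (V x) t" using DERIV_V[OF assms] DERIV_isCont by blast
    then show ?thesis
      unfolding isCont_def by (rule tendsto_within_subset) auto
  qed
qed

abbreviation dens :: "real \<times> real \<Rightarrow> real" where "dens \<equiv> permuton_density g"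

lemma dens_eq:
  "0 < x \<Longrightarrow> x < 1 \<Longrightarrow> 0 < y \<Longrightarrow> y < 1 \<Longrightarrow>
    dens (x, y) = - g' (V x y) * g (V x y) / (g x * g y)"
  and dens_eq_0: "\<not> (0 < x \<and> x < 1 \<and> 0 < y \<and> y < 1) \<Longrightarrow> dens (x, y) = 0"
  by (auto simp: permuton_density_def indicator_def)

lemma dens_commute: "dens (x, y) = dens (y, x)"
  by (auto simp: permuton_density_def indicator_def V_commute mult.commute)

lemma dens_nonneg: "dens p \<ge> 0"
proof -
  obtain x y where p: "p = (x, y)" by force
  show ?thesis
  proof (cases "0 < x \<and> x < 1 \<and> 0 < y \<and> y < 1")
    case True
    then have V: "0 < V x y" "V x y < 1" using V_pos V_less_1 by auto
    have "0 \<le> (- g' (V x y)) * g (V x y)" "0 \<le> g x * g y"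
      using True V by (intro mult_nonneg_nonneg; simp add: g'_nonpos g_nonneg)+
    then have "0 \<le> (- g' (V x y)) * g (V x y) / (g x * g y)" by (rule divide_nonneg_nonneg)
    then show ?thesis using True by (simp add: p dens_eq)
  qed (simp add: p dens_eq_0)
qed

lemma continuous_on_V_pair: "continuous_on ({0<..<1} \<times> {0<..<1}) (\<lambda>p. V (fst p) (snd p))"
proof -
  have u: "continuous_on {0<..<1} u" 
    by (intro continuous_at_imp_continuous_on) (auto intro: isCont_u)
  have w: "continuous_on {0<..} w" 
    by (intro continuous_at_imp_continuous_on) (auto intro: isCont_w)
  have "continuous_on ({0<..<1} \<times> {0<..<1}) (\<lambda>p. w (u (fst p) + u (snd p)))"
    by (rule continuous_on_compose2[OF w])
       (auto intro!: continuous_intros continuous_on_compose2[OF u] u_pos add_pos_pos)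
  then show ?thesis
    by (rule continuous_on_eq) (auto simp: V_eq)
qed

lemma borel_measurable_dens: "dens \<in> borel_measurable borel"
proof -
  have g: "continuous_on {0<..<1} g" 
    by (intro continuous_at_imp_continuous_on) (auto intro: isCont_g)
  have g': "continuous_on {0<..<1} g'" 
    by (intro continuous_at_imp_continuous_on) (auto intro: isCont_g')
  show ?thesis
    unfolding permuton_density_def[abs_def]
  proof (rule borel_measurable_continuous_on_indicator)
    have "(\<lambda>p. V (fst p) (snd p)) ` ({0<..<1} \<times> {0<..<1}) \<subseteq> {0<..<1}"
      by (auto intro!: V_pos V_less_1)
    then show "continuous_on ({0<..<1} \<times> {0<..<1})
       (\<lambda>p. - g' (V (fst p) (snd p)) * g (V (fst p) (snd p)) / (g (fst p) * g (snd p)))"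
      by (intro continuous_intros continuous_on_compose2[OF g] continuous_on_compose2[OF g'] continuous_on_V_pair)
         (auto, (metis g_pos less_imp_le order_less_irrefl)+)
  qed (intro borel_open open_Times open_greaterThanLessThan)
qed

lemma borel_measurable_dens' [measurable]: "dens \<in> borel_measurable (borel \<Otimes>\<^sub>M borel)"
  using borel_measurable_dens by (simp add: borel_prod)

text \<open>By \<open>DERIV_V\<close>, the function - g(V x t)/g(x) is an antiderivative of the
  density in t; at t = 0 it equals -1 because \<open>V x 0\<close> is \<open>x\<close>.
  Nonnegativity turns the gauge integral into a Lebesgue integral.\<close>

lemma nn_integral_dens_snd:
  assumes x: "0 < x" "x < 1" and y: "0 \<le> y" "y \<le> 1"
  shows "(\<integral>\<^sup>+t. ennreal (dens (x, t)) * indicator {..y} t \<partial>lborel) = ennreal (1 - g (V x y) / g x)"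
proof -
  have "((\<lambda>t. dens (x, t)) has_integral (- (g (V x y) / g x) - - (g (V x 0) / g x))) {0..y}"
  proof (rule fundamental_theorem_of_calculus_interior[OF y(1)])
    show "continuous_on {0..y} (\<lambda>t. - (g (V x t) / g x))"
    proof -
      have V: "continuous_on {0..y} (V x)" by (rule continuous_on_subset[OF continuous_on_V[OF x]]) (use y in auto)
      have "V x ` {0..y} \<subseteq> {0..1}" using V_le_1[of x] V_ge[of x] x y by force
      then show ?thesis 
        using g_pos[of x] x by (intro continuous_intros continuous_on_compose2[OF continuous_on_g V]) auto
    qed
    fix t assume t: "t \<in> {0<..<y}"
    then have t': "0 < t" "t < 1" using y by auto
    then have V: "0 < V x t" "V x t < 1" using V_pos V_less_1 x by auto
    have "((\<lambda>t. - (g (V x t) / g x)) has_real_derivative - (g' (V x t) * (g (V x t) / g t) / g x)) (at t)"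
      by (intro DERIV_minus DERIV_cdivide DERIV_chain2[OF DERIV_g[OF V] DERIV_V[OF x t']])
    moreover have "- (g' (V x t) * (g (V x t) / g t) / g x) = dens (x, t)"
      using x t' by (simp add: dens_eq)
    ultimately show "((\<lambda>t. - (g (V x t) / g x)) has_vector_derivative dens (x, t)) (at t)"
      by (simp add: has_real_derivative_iff_has_vector_derivative)
  qed
  moreover have "- (g (V x y) / g x) - - (g (V x 0) / g x) = 1 - g (V x y) / g x"
    using x g_pos[of x] by (simp add: V_0)
  ultimately have "((\<lambda>t. dens (x, t)) has_integral (1 - g (V x y) / g x)) {0..y}" by simp
  then have "(\<integral>\<^sup>+t. ennreal (dens (x, t)) * indicator {0..y} t \<partial>lborel) = ennreal (1 - g (V x y) / g x)"
    by (rule nn_integral_has_integral_lebesgue'[OF dens_nonneg])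
  moreover have "ennreal (dens (x, t)) * indicator {..y} t = ennreal (dens (x, t)) * indicator {0..y} t" for t
    by (cases "0 < t") (auto simp: dens_eq_0 indicator_def)
  ultimately show ?thesis by simp
qed

text \<open>At y = 1 one has V = 1 and g(V) = 0, so each vertical slice carries mass 1 and the
  density accounts for the whole permuton.\<close>

lemma nn_integral_dens_snd':
  assumes "0 < x" "x < 1"
  shows "(\<integral>\<^sup>+t. ennreal (dens (x, t)) \<partial>lborel) = 1"
proof -
  have "ennreal (dens (x, t)) = ennreal (dens (x, t)) * indicator {..1} t" for t
    by (auto simp: dens_eq_0 indicator_def)
  then show ?thesis
    using nn_integral_dens_snd[OF assms, of 1] by (simp add: V_1 g_1)
qed

section \<open>The measure with this density: marginals and c.d.f\<close>

definition P :: "(real \<times> real) measure" where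
  "P = density lborel (\<lambda>p. ennreal (dens p))"

lemma sets_P [simp, measurable_cong]: "sets P = sets borel" and space_P [simp]: "space P = UNIV"
  by (auto simp: P_def)

lemma emeasure_P_Times:
  assumes [measurable]: "A \<in> sets borel" "B \<in> sets borel"
  shows "emeasure P (A \<times> B) =
    (\<integral>\<^sup>+x. (\<integral>\<^sup>+t. ennreal (dens (x, t)) * indicator B t \<partial>lborel) * indicator A x \<partial>lborel)"
proof -
  have [measurable]: "A \<times> B \<in> sets borel" by (simp add: borel_Times)
  then have "emeasure P (A \<times> B) = (\<integral>\<^sup>+p. ennreal (dens p) * indicator (A \<times> B) p \<partial>lborel)"
    unfolding P_def using borel_measurable_dens by (intro emeasure_density) auto
  also have "\<dots> = (\<integral>\<^sup>+p. ennreal (dens p) * indicator (A \<times> B) p \<partial>(lborel \<Otimes>\<^sub>M lborel))"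
    by (simp add: lborel_prod)
  also have "\<dots> = (\<integral>\<^sup>+x. \<integral>\<^sup>+t. ennreal (dens (x, t)) * indicator (A \<times> B) (x, t) \<partial>lborel \<partial>lborel)"
    by (rule lborel.nn_integral_fst[symmetric]) measurable
  also have "\<dots> = (\<integral>\<^sup>+x. \<integral>\<^sup>+t. (ennreal (dens (x, t)) * indicator B t) * indicator A x \<partial>lborel \<partial>lborel)"
    by (auto intro!: nn_integral_cong simp: indicator_times mult_ac)
  also have "\<dots> = (\<integral>\<^sup>+x. (\<integral>\<^sup>+t. ennreal (dens (x, t)) * indicator B t \<partial>lborel) * indicator A x \<partial>lborel)"
    by (intro nn_integral_cong nn_integral_multc) measurable
  finally show ?thesis .
qed

text \<open>Tonelli and the symmetry of the density; it reduces the second marginal to the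
  first.\<close>

lemma emeasure_P_commute:
  assumes [measurable]: "A \<in> sets borel" "B \<in> sets borel"
  shows "emeasure P (A \<times> B) = emeasure P (B \<times> A)"
proof -
  have "emeasure P (A \<times> B) =
      (\<integral>\<^sup>+x. \<integral>\<^sup>+t. ennreal (dens (x, t)) * indicator B t * indicator A x \<partial>lborel \<partial>lborel)"
    unfolding emeasure_P_Times[OF assms]
    by (intro nn_integral_cong nn_integral_multc[symmetric]) measurable
  also have "\<dots> = (\<integral>\<^sup>+t. \<integral>\<^sup>+x. ennreal (dens (x, t)) * indicator B t * indicator A x \<partial>lborel \<partial>lborel)"
    by (rule lborel_pair.Fubini') measurable
  also have "\<dots> = (\<integral>\<^sup>+t. \<integral>\<^sup>+x. ennreal (dens (t, x)) * indicator A x * indicator B t \<partial>lborel \<partial>lborel)"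
    by (intro nn_integral_cong) (simp add: dens_commute mult_ac)
  also have "\<dots> = emeasure P (B \<times> A)"
    unfolding emeasure_P_Times[OF assms(2,1)]
    by (intro nn_integral_cong nn_integral_multc) measurable
  finally show ?thesis .
qed

lemma emeasure_P_UNIV:
  assumes [measurable]: "A \<in> sets borel"
  shows "emeasure P (A \<times> UNIV) = emeasure lborel (A \<inter> {0<..<1})"
proof -
  have "emeasure P (A \<times> UNIV) = (\<integral>\<^sup>+x. (\<integral>\<^sup>+t. ennreal (dens (x, t)) \<partial>lborel) * indicator A x \<partial>lborel)"
    by (subst emeasure_P_Times) auto
  also have "\<dots> = (\<integral>\<^sup>+x. indicator (A \<inter> {0<..<1}) x \<partial>lborel)"
  proof (rule nn_integral_cong)
    fix x :: real
    show "(\<integral>\<^sup>+t. ennreal (dens (x, t)) \<partial>lborel) * indicator A x = indicator (A \<inter> {0<..<1}) x"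
    proof (cases "0 < x \<and> x < 1")
      case True then show ?thesis by (simp add: nn_integral_dens_snd' indicator_def)
    next
      case False
      then have "dens (x, t) = 0" for t by (rule_tac dens_eq_0) auto
      then show ?thesis using False by (auto simp: indicator_def)
    qed
  qed
  finally show ?thesis by simp
qed

text \<open>The inner integral is 1 - g(V s y)/g(s), which by \<open>DERIV_V\<close> and the
  symmetry of \<open>V\<close> is the derivative of s - V y s. The edges y = 0 and y = 1 are
  separate cases because \<open>DERIV_V\<close> needs y in the open interval.\<close>

lemma emeasure_P_atMost:
  assumes x: "0 \<le> x" "x \<le> 1" and y: "0 \<le> y" "y \<le> 1"
  shows "emeasure P ({..x} \<times> {..y}) = ennreal (F_fun g x y)"
proof -
  have "emeasure P ({..x} \<times> {..y}) = 
      (\<integral>\<^sup>+s. (\<integral>\<^sup>+t. ennreal (dens (s, t)) * indicator {..y} t \<partial>lborel) * indicator {..x} s \<partial>lborel)"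
    by (rule emeasure_P_Times) auto
  also have "\<dots> = (\<integral>\<^sup>+s. ennreal (1 - g (V s y) / g s) * indicator {0..x} s \<partial>lborel)"
  proof (rule nn_integral_cong_AE, rule AE_I')
    \<comment> \<open>At these two points the integrands need not agree: the density is 0 there,
      whereas the closed form is 1 - g y at s = 0, and at s = 1 it is 1 because division by
      \<open>g 1\<close>, which is 0, yields 0.\<close>
    show "{0, 1::real} \<in> null_sets lborel" by (auto simp: null_sets_def emeasure_lborel_countable)
    have "(\<integral>\<^sup>+t. ennreal (dens (s, t)) * indicator {..y} t \<partial>lborel) * indicator {..x} s =
       ennreal (1 - g (V s y) / g s) * indicator {0..x} s" if "s \<noteq> 0" "s \<noteq> 1" for s
    proof (cases "0 < s \<and> s < 1")
      case True then show ?thesis using nn_integral_dens_snd[of s y] y by (simp add: indicator_def)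
    next
      case False
      then have "dens (s, t) = 0" for t by (rule_tac dens_eq_0) auto
      then show ?thesis using that False x by (auto simp: indicator_def)
    qed
    then show "{s \<in> space lborel. (\<integral>\<^sup>+t. ennreal (dens (s, t)) * indicator {..y} t \<partial>lborel) * indicator {..x} s \<noteq>
       ennreal (1 - g (V s y) / g s) * indicator {0..x} s} \<subseteq> {0, 1}" by blast
  qed
  also have "\<dots> = ennreal (F_fun g x y)"
  proof -
    have nonneg: "0 \<le> 1 - g (V s y) / g s" if "s \<in> {0..x}" for s
    proof (cases "s = 1")
      case True then show ?thesis by (simp add: g_1)
    next
      case False
      then have "g (V s y) \<le> g s" "0 < g s"
        using that x y V_ge[of s y] V_le_1[of s y] by (auto intro!: g_le g_pos)
      then show ?thesis by simp
    qed
    have "((\<lambda>s. 1 - g (V s y) / g s) has_integral F_fun g x y) {0..x}"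
    proof -
      consider "y = 0" | "y = 1" | "0 < y" "y < 1" using y by linarith
      then show ?thesis
      proof cases
        case 1
        have "((\<lambda>s. 1 - g (V s y) / g s) has_integral 0) {0..x}"
        proof (rule has_integral_spike_finite)
          \<comment> \<open>At s = 1 the integrand is 1 instead of 0, again by division by
            zero.\<close>
          show "finite {1::real}" by simp
          show "((\<lambda>s. 0) has_integral 0) {0..x}" by simp
          show "1 - g (V s y) / g s = 0" if "s \<in> {0..x} - {1}" for s
            using that 1 x g_pos[of s] by (simp add: V_0)
        qed
        then show ?thesis using 1 x by (simp add: F_fun_def V_0)
      next
        case 2
        have "((\<lambda>s::real. 1::real) has_integral x) {0..x}"
          using has_integral_const_real[of "1::real" 0 x] x by simp
        then show ?thesis using 2 by (simp add: F_fun_def V_1 g_1)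
      next
        case 3
        have "((\<lambda>s. 1 - g (V y s) / g s) has_integral ((x - V y x) - (0 - V y 0))) {0..x}"
        proof (rule fundamental_theorem_of_calculus_interior[OF x(1)])
          show "continuous_on {0..x} (\<lambda>s. s - V y s)"
            using 3 x by (intro continuous_intros continuous_on_subset[OF continuous_on_V]) auto
          fix s assume "s \<in> {0<..<x}"
          then have "((\<lambda>s. s - V y s) has_real_derivative 1 - g (V y s) / g s) (at s)"
            using 3 x by (auto intro!: derivative_eq_intros DERIV_V)
          then show "((\<lambda>s. s - V y s) has_vector_derivative 1 - g (V y s) / g s) (at s)"
            by (simp add: has_real_derivative_iff_has_vector_derivative)
        qed
        then show ?thesis using y by (simp add: F_fun_def V_commute[of _ y] V_0 algebra_simps)
      qed
    qed
    with nonneg show ?thesis by (intro nn_integral_has_integral_lebesgue')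
  qed
  finally show ?thesis .
qed

lemma emeasure_P_all: "emeasure P UNIV = 1"
  using emeasure_P_UNIV[of UNIV] by (simp add: UNIV_Times_UNIV)

lemma permuton_P: "permuton P"
proof -
  interpret prob_space P by standard (simp add: emeasure_P_all)
  have inter: "emeasure lborel (A \<inter> {0<..<1}) = emeasure lborel ({0..1} \<inter> A)"
    if [measurable]: "A \<in> sets borel" for A :: "real set"
  proof (rule emeasure_eq_AE)
    have "AE x in lborel. x \<noteq> (0::real)" "AE x in lborel. x \<noteq> (1::real)" by (rule AE_lborel_singleton)+
    then show "AE x in lborel. (x \<in> A \<inter> {0<..<1}) = (x \<in> {0..1} \<inter> A)" 
      by eventually_elim auto
  qed auto
  have fst: "distr P lborel fst = uniform_measure lborel {0..1}"
  proof (rule measure_eqI)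
    fix A assume "A \<in> sets (distr P lborel fst)"
    then have [measurable]: "A \<in> sets borel" by simp
    have "fst -` A \<inter> space P = A \<times> UNIV" by auto
    then have "emeasure (distr P lborel fst) A = emeasure P (A \<times> UNIV)"
      by (subst emeasure_distr) (auto simp: P_def borel_prod[symmetric])
    then show "emeasure (distr P lborel fst) A = emeasure (uniform_measure lborel {0..1}) A"
      by (simp add: emeasure_P_UNIV inter divide_ennreal_def)
  qed simp
  have snd: "distr P lborel snd = uniform_measure lborel {0..1}"
  proof (rule measure_eqI)
    fix A assume "A \<in> sets (distr P lborel snd)"
    then have [measurable]: "A \<in> sets borel" by simp
    have "snd -` A \<inter> space P = UNIV \<times> A" by auto
    then have "emeasure (distr P lborel snd) A = emeasure P (UNIV \<times> A)"
      by (subst emeasure_distr) (auto simp: P_def borel_prod[symmetric])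
    also have "\<dots> = emeasure P (A \<times> UNIV)" by (rule emeasure_P_commute) auto
    finally show "emeasure (distr P lborel snd) A = emeasure (uniform_measure lborel {0..1}) A"
      by (simp add: emeasure_P_UNIV inter divide_ennreal_def)
  qed simp
  have "p \<in> {0..1} \<times> {0..1}" if "0 < dens p" for p
    using that dens_eq_0[of "fst p" "snd p"] by (cases p) force
  then have "AE p in P. p \<in> {0..1} \<times> {0..1}"
    using borel_measurable_dens
    unfolding P_def by (subst AE_density) (auto simp del: mem_Times_iff)
  then have "measure P ({0..1} \<times> {0..1}) = 1"
    by (subst prob_eq_1) (auto intro: borel_closed closed_Times)
  then show ?thesis
    unfolding permuton_def using fst snd prob_space_axioms by simp
qed

lemma measure_P_atMost:
  "0 \<le> x \<Longrightarrow> x \<le> 1 \<Longrightarrow> 0 \<le> y \<Longrightarrow> y \<le> 1 \<Longrightarrow> measure P ({..x} \<times> {..y}) = F_fun g x y"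
  using V_le[of x y] by (simp add: measure_def emeasure_P_atMost F_fun_def)

end

section \<open>Uniqueness of a permuton with prescribed c.d.f. on the square\<close>

lemma permuton_measure_atMost:
  assumes P: "permuton P"
  shows "measure P ({..x} \<times> {..y}) =
    (if x < 0 \<or> y < 0 then 0 else measure P ({..min x 1} \<times> {..min y 1}))"
proof -
  interpret prob_space P using P by (simp add: permuton_def)
  have sets: "sets P = sets borel" using P by (simp add: permuton_def)
  have S: "prob ({0..1} \<times> {0..1}) = 1" using P by (simp add: permuton_def)
  have ev [simp]: "A \<times> B \<in> events" if "closed A" "closed B" for A B :: "real set"
    unfolding sets using that by (intro borel_closed closed_Times)
  \<comment> \<open>The complement of the square is null, so only the trace on the square counts. A
    negative corner coordinate gives an empty trace, and a coordinate above 1 may be lowered to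
    1.\<close>
  have *: "prob A = prob B" if "A \<in> events" "B \<in> events" 
    "A \<inter> ({0..1} \<times> {0..1}) = B \<inter> ({0..1} \<times> {0..1})" for A B
  proof -
    have "AE p in P. p \<in> {0..1} \<times> {0..1}" using S by (subst (asm) prob_eq_1) auto
    then have "AE p in P. p \<in> A \<longleftrightarrow> p \<in> B" by eventually_elim (use that(3) in blast)
    then show ?thesis using that by (intro measure_eq_AE) auto
  qed
  show ?thesis
  proof (cases "x < 0 \<or> y < 0")
    case True
    then have "prob ({..x} \<times> {..y}) = prob {}" by (intro *) auto
    then show ?thesis using True by simp
  next
    case False
    then have "prob ({..x} \<times> {..y}) = prob ({..min x 1} \<times> {..min y 1})" by (intro *) auto
    then show ?thesis using False by simp
  qed
qed

text \<open>Lower-left quadrants are closed under intersection and generate the Borel sets of the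
  plane; \<open>permuton_measure_atMost\<close> extends the agreement from corners in the square to
  all corners. This is the uniqueness that the description in \<open>permuton_of\<close>
  requires.\<close>

lemma permuton_eqI:
  assumes P: "permuton P" and Q: "permuton Q"
    and eq: "\<And>x y. x \<in> {0..1} \<Longrightarrow> y \<in> {0..1} \<Longrightarrow> measure P ({..x} \<times> {..y}) = measure Q ({..x} \<times> {..y})"
  shows "P = Q"
proof -
  interpret P: prob_space P using P by (simp add: permuton_def)
  interpret Q: prob_space Q using Q by (simp add: permuton_def)
  have sets: "sets P = sets borel" "sets Q = sets borel"
    using P Q by (simp_all add: permuton_def)
  define E :: "(real \<times> real) set set" where "E = range (\<lambda>a. {..a})"
  have E: "sets borel = sigma_sets UNIV E"
    unfolding E_def by (subst borel_eq_atMost) simp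
  have atMost: "{..a} = {..fst a} \<times> {..snd a}" for a :: "real \<times> real"
    by (auto simp: less_eq_prod_def)
  show ?thesis
  proof (rule measure_eqI_generator_eq[where E = E and \<Omega> = UNIV and A = "\<lambda>n::nat. {..(real n, real n)}"])
    show "Int_stable E"
      by (auto simp: E_def Int_stable_def atMost Times_Int_Times intro!: image_eqI[where x = "(min _ _, min _ _)"])
    show "emeasure P X = emeasure Q X" if "X \<in> E" for X
    proof -
      obtain a where "X = {..a}" using \<open>X \<in> E\<close> by (auto simp: E_def)
      then have X: "X = {..fst a} \<times> {..snd a}" by (simp only: atMost)
      have "measure P X = measure Q X"
        unfolding X permuton_measure_atMost[OF P, of "fst a" "snd a"] permuton_measure_atMost[OF Q, of "fst a" "snd a"]
        using eq by auto
      then show ?thesis by (simp add: P.emeasure_eq_measure Q.emeasure_eq_measure)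
    qed
    show "(\<Union>n::nat. {..(real n, real n)}) = UNIV"
    proof safe
      fix x y :: real
      obtain n :: nat where "max x y \<le> real n" using real_arch_simple by blast
      then show "(x, y) \<in> (\<Union>n::nat. {..(real n, real n)})" by (auto simp: less_eq_prod_def)
    qed simp
  qed (auto simp: E sets E_def)
qed

context admissible_function begin

lemma permuton_of_eq: "permuton_of g = density lborel (\<lambda>p. ennreal (dens p))"
proof -
  have "permuton_of g = P"
    unfolding permuton_of_def
  proof (rule the_equality)
    show "permuton P \<and> (\<forall>x\<in>{0..1}. \<forall>y\<in>{0..1}. measure P ({..x} \<times> {..y}) = F_fun g x y)"
      using permuton_P measure_P_atMost by simp
    show "Q = P" if "permuton Q \<and> (\<forall>x\<in>{0..1}. \<forall>y\<in>{0..1}. measure Q ({..x} \<times> {..y}) = F_fun g x y)" for Q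
      using that measure_P_atMost by (intro permuton_eqI[OF _ permuton_P]) simp_all
  qed
  then show ?thesis by (simp add: P_def)
qed

end

section \<open>Asymptotics of the densities\<close>

locale scaled_family =
  fixes g :: "real \<Rightarrow> real \<Rightarrow> real" and \<gamma> \<psi> :: "real \<Rightarrow> real"
  assumes scaled: "scaled_log_deriv_assumption g \<gamma> \<psi>"
begin

abbreviation \<phi> :: "real \<Rightarrow> real \<Rightarrow> real" where "\<phi> \<equiv> psi_scaled g \<gamma>"

lemma admissible: "\<alpha> \<ge> 1 \<Longrightarrow> admissible_function (g \<alpha>)"
  using scaled by unfold_locales (auto simp: scaled_log_deriv_assumption_def)

lemma \<gamma>_pos: "\<alpha> \<ge> 1 \<Longrightarrow> \<gamma> \<alpha> > 0"
  using scaled by (auto simp: scaled_log_deriv_assumption_def)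

lemma \<gamma>_at_top: "filterlim \<gamma> at_top at_top"
  using scaled by (auto simp: scaled_log_deriv_assumption_def)

lemma \<psi>_pos: "0 \<le> s \<Longrightarrow> s < 1 \<Longrightarrow> \<psi> s > 0"
  using scaled by (auto simp: scaled_log_deriv_assumption_def)

lemma \<phi>_uniform_limit: "0 \<le> a \<Longrightarrow> a \<le> b \<Longrightarrow> b < 1 \<Longrightarrow> uniform_limit {a..b} \<phi> \<psi> at_top"
  using scaled by (auto simp: scaled_log_deriv_assumption_def)

lemma \<phi>_equicontinuous:
  assumes "0 \<le> a" "a \<le> b" "b < 1" "\<epsilon> > 0"
  obtains \<delta> where "\<delta> > 0" "\<And>\<alpha> s t. \<alpha> \<ge> 1 \<Longrightarrow> s \<in> {a..b} \<Longrightarrow> t \<in> {a..b} \<Longrightarrow> \<bar>s - t\<bar> < \<delta> \<Longrightarrow> \<bar>\<phi> \<alpha> s - \<phi> \<alpha> t\<bar> < \<epsilon>"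
proof -
  have "\<forall>a b. 0 \<le> a \<and> a \<le> b \<and> b < 1 \<longrightarrow>
        (\<forall>\<epsilon>>0. \<exists>\<delta>>0. \<forall>\<alpha>\<ge>1. \<forall>s\<in>{a..b}. \<forall>t\<in>{a..b}.
           \<bar>s - t\<bar> < \<delta> \<longrightarrow> \<bar>\<phi> \<alpha> s - \<phi> \<alpha> t\<bar> < \<epsilon>)"
    using scaled unfolding scaled_log_deriv_assumption_def by blast
  then obtain \<delta> where "\<delta> > 0" "\<forall>\<alpha>\<ge>1. \<forall>s\<in>{a..b}. \<forall>t\<in>{a..b}.
           \<bar>s - t\<bar> < \<delta> \<longrightarrow> \<bar>\<phi> \<alpha> s - \<phi> \<alpha> t\<bar> < \<epsilon>"
    using assms by metis
  then show ?thesis by (intro that[of \<delta>]) auto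
qed

lemma eventually_ge_1: "\<forall>\<^sub>F \<alpha>::real in at_top. \<alpha> \<ge> 1"
  by (rule eventually_ge_at_top)

lemma \<phi>_tendsto_\<psi>: 
  assumes "0 \<le> s" "s < 1" 
  shows "((\<lambda>\<alpha>. \<phi> \<alpha> s) \<longlongrightarrow> \<psi> s) at_top"
  using tendsto_uniform_limitI[OF \<phi>_uniform_limit[of s s]] assms by simp

text \<open>\<open>\<phi> \<alpha> s\<close> is compared with \<open>\<phi> \<alpha> p\<close> by
  equicontinuity, uniformly in \<alpha>, and \<open>\<phi> \<alpha> p\<close> with
  \<open>\<psi> p\<close> by convergence at the single point p. The resulting neighbourhood does not
  depend on \<alpha>.\<close>

lemma \<phi>_near:
  assumes "0 < p" "p < 1" "\<epsilon> > 0"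
  obtains \<delta> where "\<delta> > 0" "\<delta> < p" "p + \<delta> < 1"
    "\<forall>\<^sub>F \<alpha> in at_top. \<forall>s. \<bar>s - p\<bar> \<le> \<delta> \<longrightarrow> \<bar>\<phi> \<alpha> s - \<psi> p\<bar> < \<epsilon>"
proof -
  define b where "b = (p + 1) / 2"
  have b: "p < b" "b < 1" using assms by (auto simp: b_def)
  obtain d where d: "d > 0" "\<And>\<alpha> s t. \<alpha> \<ge> 1 \<Longrightarrow> s \<in> {0..b} \<Longrightarrow> t \<in> {0..b} \<Longrightarrow> \<bar>s - t\<bar> < d \<Longrightarrow> \<bar>\<phi> \<alpha> s - \<phi> \<alpha> t\<bar> < \<epsilon> / 2"
    using \<phi>_equicontinuous[of 0 b "\<epsilon> / 2"] assms b by auto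
  \<comment> \<open>The neighbourhood is closed while equicontinuity asks for a strict inequality,
    hence the halving; the other two terms keep it inside (0,b).\<close>
  define \<delta> where "\<delta> = min d (min p (b - p)) / 2"
  have \<delta>: "\<delta> > 0" "\<delta> < p" "\<delta> < b - p" "\<delta> < d" using assms b d by (auto simp: \<delta>_def min_def)
  have "\<forall>\<^sub>F \<alpha> in at_top. \<bar>\<phi> \<alpha> p - \<psi> p\<bar> < \<epsilon> / 2"
    using \<phi>_tendsto_\<psi>[of p] assms unfolding tendsto_iff dist_real_def by (auto dest!: spec[of _ "\<epsilon> / 2"])
  then have "\<forall>\<^sub>F \<alpha> in at_top. \<forall>s. \<bar>s - p\<bar> \<le> \<delta> \<longrightarrow> \<bar>\<phi> \<alpha> s - \<psi> p\<bar> < \<epsilon>"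
    using eventually_ge_1
  proof eventually_elim
    case (elim \<alpha>)
    show ?case
    proof (intro allI impI)
      fix s assume "\<bar>s - p\<bar> \<le> \<delta>"
      then have "\<bar>\<phi> \<alpha> s - \<phi> \<alpha> p\<bar> < \<epsilon> / 2" using \<delta> assms elim by (intro d) auto
      with elim show "\<bar>\<phi> \<alpha> s - \<psi> p\<bar> < \<epsilon>" by linarith
    qed
  qed
  then show ?thesis using that \<delta> b by auto
qed

lemma tendsto_eventually_near:
  assumes "(s \<longlongrightarrow> (p::real)) F" "\<delta> > 0"
  shows "\<forall>\<^sub>F \<alpha> in F. \<bar>s \<alpha> - p\<bar> < \<delta>"
  using assms by (auto simp: tendsto_iff dist_real_def)

lemma tendsto_\<phi>:
  assumes p: "0 < p" "p < 1" and s: "(s \<longlongrightarrow> p) at_top"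
  shows "((\<lambda>\<alpha>. \<phi> \<alpha> (s \<alpha>)) \<longlongrightarrow> \<psi> p) at_top"
  unfolding tendsto_iff dist_real_def
proof (intro allI impI)
  fix \<epsilon> :: real assume "\<epsilon> > 0"
  obtain \<delta> where \<delta>: "\<delta> > 0" "\<delta> < p" "p + \<delta> < 1"
    "\<forall>\<^sub>F \<alpha> in at_top. \<forall>s. \<bar>s - p\<bar> \<le> \<delta> \<longrightarrow> \<bar>\<phi> \<alpha> s - \<psi> p\<bar> < \<epsilon>"
    by (rule \<phi>_near[OF p \<open>\<epsilon> > 0\<close>])
  show "\<forall>\<^sub>F \<alpha> in at_top. \<bar>\<phi> \<alpha> (s \<alpha>) - \<psi> p\<bar> < \<epsilon>"
    using \<delta>(4) tendsto_eventually_near[OF s \<delta>(1)] by eventually_elim auto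
qed

section \<open>Exponential behaviour of \<open>g\<close> near a point\<close>

lemma deriv_g:
  assumes "\<alpha> \<ge> 1" "0 < s" "s < 1"
  shows "deriv01 (g \<alpha>) s = - \<gamma> \<alpha> * \<phi> \<alpha> s * g \<alpha> s"
  using \<gamma>_pos[OF assms(1)] admissible_function.g_pos[OF admissible[OF assms(1)], of s] assms
  by (simp add: psi_scaled_def)

text \<open>Read as g' = - \<gamma> \<phi> g, the definition of \<phi> says that ln g has derivative
  - \<gamma> \<phi>; the rest is the mean value theorem.\<close>

lemma ln_g_diff:
  assumes \<alpha>: "\<alpha> \<ge> 1" and a: "0 < a" "a < b" "b < 1"
  obtains \<xi> where "a < \<xi>" "\<xi> < b" "ln (g \<alpha> b) - ln (g \<alpha> a) = - \<gamma> \<alpha> * \<phi> \<alpha> \<xi> * (b - a)"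
proof -
  interpret admissible_function "g \<alpha>" by (rule admissible[OF \<alpha>])
  have "((\<lambda>x. ln (g \<alpha> x)) has_real_derivative (- \<gamma> \<alpha> * \<phi> \<alpha> x)) (at x)" if "a \<le> x" "x \<le> b" for x
  proof -
    have x: "0 < x" "x < 1" using that a by auto
    have "((\<lambda>x. ln (g \<alpha> x)) has_real_derivative (1 / g \<alpha> x * deriv01 (g \<alpha>) x)) (at x)"
      using x g_pos[of x] by (intro DERIV_chain2[OF DERIV_ln_divide DERIV_g]) auto
    then show ?thesis using deriv_g[OF \<alpha> x] g_pos[of x] x by simp
  qed
  from MVT2[OF a(2) this] show ?thesis using that by (auto simp: mult_ac)
qed

text \<open>The logarithm of the ratio is - \<phi>(\<xi>) times \<gamma> (x - y) for some \<xi>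
  between x and y. Squeezing makes \<xi> tend to p, and \<open>tendsto_\<phi>\<close> allows the
  argument to move with \<alpha>.\<close>

lemma g_ratio_tendsto:
  assumes p: "0 < p" "p < 1" and x: "(x \<longlongrightarrow> p) at_top" and y: "(y \<longlongrightarrow> p) at_top"
    and c: "((\<lambda>\<alpha>. \<gamma> \<alpha> * (x \<alpha> - y \<alpha>)) \<longlongrightarrow> c) at_top"
  shows "((\<lambda>\<alpha>. g \<alpha> (x \<alpha>) / g \<alpha> (y \<alpha>)) \<longlongrightarrow> exp (- \<psi> p * c)) at_top"
proof -
  define \<rho> where "\<rho> = min p (1 - p)"
  have \<rho>: "\<rho> > 0" "\<rho> \<le> p" "\<rho> \<le> 1 - p" using p by (auto simp: \<rho>_def)
  have near: "\<forall>\<^sub>F \<alpha> in at_top. \<alpha> \<ge> 1 \<and> 0 < x \<alpha> \<and> x \<alpha> < 1 \<and> 0 < y \<alpha> \<and> y \<alpha> < 1"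
    using eventually_ge_1 tendsto_eventually_near[OF x \<rho>(1)] tendsto_eventually_near[OF y \<rho>(1)]
    by eventually_elim (use \<rho> in auto)
  have "\<exists>\<xi>. min (x \<alpha>) (y \<alpha>) \<le> \<xi> \<and> \<xi> \<le> max (x \<alpha>) (y \<alpha>) \<and>
      ln (g \<alpha> (x \<alpha>)) - ln (g \<alpha> (y \<alpha>)) = - \<phi> \<alpha> \<xi> * (\<gamma> \<alpha> * (x \<alpha> - y \<alpha>))"
    if \<alpha>: "\<alpha> \<ge> 1 \<and> 0 < x \<alpha> \<and> x \<alpha> < 1 \<and> 0 < y \<alpha> \<and> y \<alpha> < 1" for \<alpha>
  proof (cases "x \<alpha>" "y \<alpha>" rule: linorder_cases)
    case less
    obtain \<xi> where \<xi>: "x \<alpha> < \<xi>" "\<xi> < y \<alpha>"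
      "ln (g \<alpha> (y \<alpha>)) - ln (g \<alpha> (x \<alpha>)) = - \<gamma> \<alpha> * \<phi> \<alpha> \<xi> * (y \<alpha> - x \<alpha>)"
      by (rule ln_g_diff[of \<alpha> "x \<alpha>" "y \<alpha>"]) (use \<alpha> less in auto)
    then have "ln (g \<alpha> (x \<alpha>)) - ln (g \<alpha> (y \<alpha>)) = - \<phi> \<alpha> \<xi> * (\<gamma> \<alpha> * (x \<alpha> - y \<alpha>))"
      by (simp add: algebra_simps)
    then show ?thesis using \<xi> by (intro exI[of _ \<xi>]) auto
  next
    case equal
    then show ?thesis by auto
  next
    case greater
    obtain \<xi> where \<xi>: "y \<alpha> < \<xi>" "\<xi> < x \<alpha>"
      "ln (g \<alpha> (x \<alpha>)) - ln (g \<alpha> (y \<alpha>)) = - \<gamma> \<alpha> * \<phi> \<alpha> \<xi> * (x \<alpha> - y \<alpha>)"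
      by (rule ln_g_diff[of \<alpha> "y \<alpha>" "x \<alpha>"]) (use \<alpha> greater in auto)
    then have "ln (g \<alpha> (x \<alpha>)) - ln (g \<alpha> (y \<alpha>)) = - \<phi> \<alpha> \<xi> * (\<gamma> \<alpha> * (x \<alpha> - y \<alpha>))"
      by (simp add: algebra_simps)
    then show ?thesis using \<xi> by (intro exI[of _ \<xi>]) auto
  qed
  \<comment> \<open>The intermediate points must form one family indexed by \<alpha> before a limit
    can be taken along it.\<close>
  then have "\<exists>\<xi>. \<forall>\<alpha>. \<alpha> \<ge> 1 \<and> 0 < x \<alpha> \<and> x \<alpha> < 1 \<and> 0 < y \<alpha> \<and> y \<alpha> < 1 \<longrightarrow>
      min (x \<alpha>) (y \<alpha>) \<le> \<xi> \<alpha> \<and> \<xi> \<alpha> \<le> max (x \<alpha>) (y \<alpha>) \<and>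
      ln (g \<alpha> (x \<alpha>)) - ln (g \<alpha> (y \<alpha>)) = - \<phi> \<alpha> (\<xi> \<alpha>) * (\<gamma> \<alpha> * (x \<alpha> - y \<alpha>))"
    by (intro choice allI) blast
  then obtain \<xi> where \<xi>: "\<And>\<alpha>. \<alpha> \<ge> 1 \<and> 0 < x \<alpha> \<and> x \<alpha> < 1 \<and> 0 < y \<alpha> \<and> y \<alpha> < 1 \<Longrightarrow>
      min (x \<alpha>) (y \<alpha>) \<le> \<xi> \<alpha> \<and> \<xi> \<alpha> \<le> max (x \<alpha>) (y \<alpha>) \<and>
      ln (g \<alpha> (x \<alpha>)) - ln (g \<alpha> (y \<alpha>)) = - \<phi> \<alpha> (\<xi> \<alpha>) * (\<gamma> \<alpha> * (x \<alpha> - y \<alpha>))"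
    by blast
  have "(\<xi> \<longlongrightarrow> p) at_top"
  proof (rule real_tendsto_sandwich)
    show "((\<lambda>\<alpha>. min (x \<alpha>) (y \<alpha>)) \<longlongrightarrow> p) at_top" "((\<lambda>\<alpha>. max (x \<alpha>) (y \<alpha>)) \<longlongrightarrow> p) at_top"
      using tendsto_min[OF x y] tendsto_max[OF x y] by simp_all
    show "\<forall>\<^sub>F \<alpha> in at_top. min (x \<alpha>) (y \<alpha>) \<le> \<xi> \<alpha>" "\<forall>\<^sub>F \<alpha> in at_top. \<xi> \<alpha> \<le> max (x \<alpha>) (y \<alpha>)"
      using near by (eventually_elim, use \<xi> in blast)+
  qed
  then have "((\<lambda>\<alpha>. exp (- \<phi> \<alpha> (\<xi> \<alpha>) * (\<gamma> \<alpha> * (x \<alpha> - y \<alpha>)))) \<longlongrightarrow> exp (- \<psi> p * c)) at_top"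
    by (intro tendsto_intros tendsto_\<phi> p c)
  moreover have "\<forall>\<^sub>F \<alpha> in at_top. exp (- \<phi> \<alpha> (\<xi> \<alpha>) * (\<gamma> \<alpha> * (x \<alpha> - y \<alpha>))) = g \<alpha> (x \<alpha>) / g \<alpha> (y \<alpha>)"
    using near
  proof eventually_elim
    case (elim \<alpha>)
    interpret admissible_function "g \<alpha>" using elim admissible by blast
    have "g \<alpha> (x \<alpha>) > 0" "g \<alpha> (y \<alpha>) > 0" using elim by (auto intro!: g_pos)
    then show ?case using \<xi>[OF elim] by (metis exp_diff exp_ln)
  qed
  ultimately show ?thesis by (rule Lim_transform_eventually)
qed

lemma g_decay:
  assumes "\<alpha> \<ge> 1" "0 < a" "a < b" "b < 1" and \<phi>: "\<And>s. a < s \<Longrightarrow> s < b \<Longrightarrow> c \<le> \<phi> \<alpha> s"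
  shows "g \<alpha> b / g \<alpha> a \<le> exp (- \<gamma> \<alpha> * (c * (b - a)))"
proof -
  interpret admissible_function "g \<alpha>" using assms admissible by blast
  obtain \<xi> where \<xi>: "a < \<xi>" "\<xi> < b" "ln (g \<alpha> b) - ln (g \<alpha> a) = - \<gamma> \<alpha> * \<phi> \<alpha> \<xi> * (b - a)"
    by (rule ln_g_diff[OF assms(1-4)])
  have "g \<alpha> b / g \<alpha> a = exp (- \<gamma> \<alpha> * \<phi> \<alpha> \<xi> * (b - a))"
    using \<xi>(3) g_pos[of a] g_pos[of b] assms by (metis exp_diff exp_ln less_imp_le less_trans)
  also have "\<dots> \<le> exp (- \<gamma> \<alpha> * (c * (b - a)))"
    using \<phi>[OF \<xi>(1,2)] \<gamma>_pos[OF assms(1)] assms by (simp add: mult.assoc mult_right_mono)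
  finally show ?thesis .
qed

text \<open>The second limit serves the upper bound in \<open>\<gamma>_u_g_bounds\<close>, where the
  error from the left end point carries an extra factor \<gamma>.\<close>

lemma exp_\<gamma>_tendsto_0: 
  assumes "c > 0"
  shows "((\<lambda>\<alpha>. exp (- \<gamma> \<alpha> * c)) \<longlongrightarrow> 0) at_top" "((\<lambda>\<alpha>. \<gamma> \<alpha> * exp (- \<gamma> \<alpha> * c)) \<longlongrightarrow> 0) at_top"
proof -
  have "filterlim (\<lambda>\<alpha>. \<gamma> \<alpha> * c) at_top at_top"
    using filterlim_at_top_mult_tendsto_pos[OF tendsto_const assms \<gamma>_at_top] by simp
  note lim = filterlim_compose[OF tendsto_power_div_exp_0 this]
  show "((\<lambda>\<alpha>. exp (- \<gamma> \<alpha> * c)) \<longlongrightarrow> 0) at_top"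
    using lim[of 0] by (simp add: exp_minus field_simps)
  have "((\<lambda>\<alpha>. 1 / c * ((\<gamma> \<alpha> * c) ^ 1 / exp (\<gamma> \<alpha> * c))) \<longlongrightarrow> 1 / c * 0) at_top"
    by (intro tendsto_mult tendsto_const lim)
  then show "((\<lambda>\<alpha>. \<gamma> \<alpha> * exp (- \<gamma> \<alpha> * c)) \<longlongrightarrow> 0) at_top"
    using assms by (simp add: exp_minus field_simps)
qed

text \<open>Since \<open>(1/g)' = \<gamma> \<phi> u'\<close>, two-sided bounds on \<open>\<phi>\<close> let \<open>1/g\<close> control \<open>\<gamma> u\<close>; the exponential
  decay of \<open>g\<close> makes the contribution of the left end point negligible.\<close>

lemma \<gamma>_u_g_bounds:
  assumes p: "0 < p" "p < 1" and s: "(s \<longlongrightarrow> p) at_top" and \<epsilon>: "0 < \<epsilon>" "\<epsilon> < \<psi> p"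
  obtains c where "c > 0"
    "\<forall>\<^sub>F \<alpha> in at_top. (1 - exp (- \<gamma> \<alpha> * c)) / (\<psi> p + \<epsilon>) \<le> \<gamma> \<alpha> * u_fun (g \<alpha>) (s \<alpha>) * g \<alpha> (s \<alpha>) \<and>
       \<gamma> \<alpha> * u_fun (g \<alpha>) (s \<alpha>) * g \<alpha> (s \<alpha>) \<le> 1 / (\<psi> p - \<epsilon>) + \<gamma> \<alpha> * exp (- \<gamma> \<alpha> * c)"
proof -
  obtain \<delta> where \<delta>: "\<delta> > 0" "\<delta> < p" "p + \<delta> < 1"
    "\<forall>\<^sub>F \<alpha> in at_top. \<forall>s. \<bar>s - p\<bar> \<le> \<delta> \<longrightarrow> \<bar>\<phi> \<alpha> s - \<psi> p\<bar> < \<epsilon>"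
    by (rule \<phi>_near[OF p \<epsilon>(1)])
  \<comment> \<open>\<open>a\<close> is the left end of the neighbourhood in which \<phi> is
    controlled. Eventually s stays more than \<delta>/2 to the right of it, and decay at rate
    \<psi>(p) - \<epsilon> over that length produces \<open>c\<close>.\<close>
  define a where "a = p - \<delta>"
  define c where "c = (\<psi> p - \<epsilon>) * (\<delta> / 2)"
  have "c > 0" using \<epsilon> \<delta> by (simp add: c_def)
  have "\<delta> / 2 > 0" using \<delta> by simp
  have "\<forall>\<^sub>F \<alpha> in at_top. (1 - exp (- \<gamma> \<alpha> * c)) / (\<psi> p + \<epsilon>) \<le> \<gamma> \<alpha> * u_fun (g \<alpha>) (s \<alpha>) * g \<alpha> (s \<alpha>) \<and>
       \<gamma> \<alpha> * u_fun (g \<alpha>) (s \<alpha>) * g \<alpha> (s \<alpha>) \<le> 1 / (\<psi> p - \<epsilon>) + \<gamma> \<alpha> * exp (- \<gamma> \<alpha> * c)"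
    using \<delta>(4) eventually_ge_1 tendsto_eventually_near[OF s \<open>\<delta> / 2 > 0\<close>]
  proof eventually_elim
    case (elim \<alpha>)
    interpret admissible_function "g \<alpha>" using elim admissible by blast
    note \<gamma> = \<gamma>_pos[OF elim(2)]
    let ?s = "s \<alpha>" let ?g = "g \<alpha>"
    have bounds: "0 < a" "a + \<delta> / 2 < ?s" "?s < p + \<delta>" using elim(3) \<delta> unfolding a_def by linarith+
    then have s01: "0 < ?s" "?s < 1" "a < ?s" "a < 1" using \<delta> by auto
    have g: "?g a > 0" "?g ?s > 0" using bounds s01 by (auto intro!: g_pos)
    have \<phi>: "\<psi> p - \<epsilon> \<le> \<phi> \<alpha> z" "\<phi> \<alpha> z \<le> \<psi> p + \<epsilon>" if "a < z" "z < ?s" for z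
      using elim(1)[rule_format, of z] that bounds by (auto simp: a_def abs_le_iff abs_less_iff)
    \<comment> \<open>The sign of this derivative is that of \<phi> - k, so k = \<psi>(p) -
      \<epsilon> makes the combination nondecreasing and k = \<psi>(p) + \<epsilon> makes it
      nonincreasing.\<close>
    have der: "((\<lambda>x. 1 / ?g x - \<gamma> \<alpha> * k * u x) has_real_derivative \<gamma> \<alpha> * (\<phi> \<alpha> z - k) / ?g z) (at z)"
      if "a < z" "z < ?s" for z k
    proof -
      have z: "0 < z" "z < 1" "?g z > 0" using that s01 bounds by (auto intro!: g_pos)
      have "((\<lambda>x. 1 / ?g x) has_real_derivative (0 * ?g z - 1 * g' z) / (?g z * ?g z)) (at z)"
        using z by (intro DERIV_divide DERIV_g) auto
      then have "((\<lambda>x. 1 / ?g x - \<gamma> \<alpha> * k * u x) has_real_derivative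
          (0 * ?g z - 1 * g' z) / (?g z * ?g z) - \<gamma> \<alpha> * k * (1 / ?g z)) (at z)"
        using z by (intro DERIV_diff DERIV_cmult DERIV_u)
      moreover have "(0 * ?g z - 1 * g' z) / (?g z * ?g z) - \<gamma> \<alpha> * k * (1 / ?g z) = \<gamma> \<alpha> * (\<phi> \<alpha> z - k) / ?g z"
        using z by (simp add: deriv_g[OF elim(2)] field_simps)
      ultimately show ?thesis by simp
    qed
    have cont: "continuous_on {a..?s} (\<lambda>x. 1 / ?g x - \<gamma> \<alpha> * k * u x)" for k
      using bounds s01 
      by (intro continuous_intros continuous_on_subset[OF continuous_on_inverse_g[OF s01(2)]]
           continuous_on_subset[OF continuous_on_u[OF s01(2)]]) auto
    have lower: "1 / ?g a - \<gamma> \<alpha> * (\<psi> p - \<epsilon>) * u a \<le> 1 / ?g ?s - \<gamma> \<alpha> * (\<psi> p - \<epsilon>) * u ?s"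
    proof (rule DERIV_nonneg_imp_increasing_open[OF less_imp_le[OF s01(3)] _ cont])
      fix z assume z: "a < z" "z < ?s"
      have "0 \<le> \<gamma> \<alpha> * (\<phi> \<alpha> z - (\<psi> p - \<epsilon>)) / ?g z"
        using \<phi>[OF z] \<gamma> g_pos[of z] z s01 bounds by simp
      then show "\<exists>y. ((\<lambda>x. 1 / ?g x - \<gamma> \<alpha> * (\<psi> p - \<epsilon>) * u x) has_real_derivative y) (at z) \<and> 0 \<le> y"
        using der[OF z] by blast
    qed
    have upper: "1 / ?g a - \<gamma> \<alpha> * (\<psi> p + \<epsilon>) * u a \<ge> 1 / ?g ?s - \<gamma> \<alpha> * (\<psi> p + \<epsilon>) * u ?s"
    proof (rule DERIV_nonpos_imp_decreasing_open[OF less_imp_le[OF s01(3)] _ cont])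
      fix z assume z: "a < z" "z < ?s"
      have "0 \<ge> \<gamma> \<alpha> * (\<phi> \<alpha> z - (\<psi> p + \<epsilon>)) / ?g z"
        using \<phi>[OF z] \<gamma> g_pos[of z] z s01 bounds by (simp add: divide_le_0_iff mult_le_0_iff)
      then show "\<exists>y. ((\<lambda>x. 1 / ?g x - \<gamma> \<alpha> * (\<psi> p + \<epsilon>) * u x) has_real_derivative y) (at z) \<and> y \<le> 0"
        using der[OF z] by blast
    qed
    have ratio: "?g ?s / ?g a \<le> exp (- \<gamma> \<alpha> * c)"
    proof -
      have "?g ?s / ?g a \<le> exp (- \<gamma> \<alpha> * ((\<psi> p - \<epsilon>) * (?s - a)))"
        using bounds s01 \<phi> by (intro g_decay elim) auto
      also have "\<dots> \<le> exp (- \<gamma> \<alpha> * c)"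
        using \<gamma> \<epsilon> bounds by (simp add: c_def)
      finally show ?thesis .
    qed
    \<comment> \<open>Once \<open>u a\<close> is traded for 1/g(a), multiplication by g(s) lets the
      left end point enter only through the small ratio g(s)/g(a).\<close>
    have ua: "0 \<le> u a" "u a \<le> 1 / ?g a"
    proof -
      show "0 \<le> u a" using u_nonneg bounds s01 by auto
      have "u a \<le> a / ?g a" using u_diff_bounds(2)[of 0 a] u_0 bounds s01 by simp
      also have "\<dots> \<le> 1 / ?g a" using g s01 by (intro divide_right_mono) auto
      finally show "u a \<le> 1 / ?g a" .
    qed
    let ?r = "\<gamma> \<alpha> * u ?s * ?g ?s"
    have "1 \<le> ?g ?s / ?g a + (\<psi> p + \<epsilon>) * ?r"
    proof -
      have "1 / ?g ?s \<le> 1 / ?g a + \<gamma> \<alpha> * (\<psi> p + \<epsilon>) * u ?s"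
      proof -
        have "0 \<le> \<gamma> \<alpha> * (\<psi> p + \<epsilon>) * u a" using \<gamma> \<epsilon> ua by simp
        then show ?thesis using upper by linarith
      qed
      then have "1 / ?g ?s * ?g ?s \<le> (1 / ?g a + \<gamma> \<alpha> * (\<psi> p + \<epsilon>) * u ?s) * ?g ?s"
        using g by (intro mult_right_mono) auto
      then show ?thesis using g by (simp add: algebra_simps)
    qed
    then have "(1 - exp (- \<gamma> \<alpha> * c)) / (\<psi> p + \<epsilon>) \<le> ?r"
      using ratio \<epsilon> by (simp add: pos_divide_le_eq mult.commute)
    moreover have "?r \<le> 1 / (\<psi> p - \<epsilon>) + \<gamma> \<alpha> * exp (- \<gamma> \<alpha> * c)"
    proof -
      have "\<gamma> \<alpha> * (\<psi> p - \<epsilon>) * u ?s \<le> 1 / ?g ?s + \<gamma> \<alpha> * (\<psi> p - \<epsilon>) * u a"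
        using lower g by (smt (verit) divide_pos_pos)
      also have "\<dots> \<le> 1 / ?g ?s + \<gamma> \<alpha> * (\<psi> p - \<epsilon>) * (1 / ?g a)"
        using \<gamma> \<epsilon> ua by (intro add_left_mono mult_left_mono) auto
      finally have "\<gamma> \<alpha> * (\<psi> p - \<epsilon>) * u ?s * ?g ?s \<le> (1 / ?g ?s + \<gamma> \<alpha> * (\<psi> p - \<epsilon>) * (1 / ?g a)) * ?g ?s"
        using g by (intro mult_right_mono) auto
      moreover have "(1 / ?g ?s + \<gamma> \<alpha> * k * (1 / ?g a)) * ?g ?s = 1 + k * (\<gamma> \<alpha> * (?g ?s / ?g a))"
        "\<gamma> \<alpha> * k * u ?s * ?g ?s = k * ?r" for k
        using g by (simp_all add: distrib_right)
      ultimately have "(\<psi> p - \<epsilon>) * ?r \<le> 1 + (\<psi> p - \<epsilon>) * (\<gamma> \<alpha> * (?g ?s / ?g a))"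
        by simp
      also have "\<dots> \<le> 1 + (\<psi> p - \<epsilon>) * (\<gamma> \<alpha> * exp (- \<gamma> \<alpha> * c))"
        using ratio \<gamma> \<epsilon> by (intro add_left_mono mult_left_mono) auto
      finally show ?thesis using \<epsilon> by (simp add: field_simps)
    qed
    ultimately show ?case by blast
  qed
  then show ?thesis using that \<open>c > 0\<close> by blast
qed

text \<open>The error \<epsilon> is fixed before \<alpha> grows: given a threshold l, it is chosen
  with l still below 1/(\<psi>(p) + \<epsilon>), or still above 1/(\<psi>(p) - \<epsilon>); then the
  exponential terms vanish.\<close>

lemma \<gamma>_u_g_tendsto:
  assumes p: "0 < p" "p < 1" and s: "(s \<longlongrightarrow> p) at_top"
  shows "((\<lambda>\<alpha>. \<gamma> \<alpha> * u_fun (g \<alpha>) (s \<alpha>) * g \<alpha> (s \<alpha>)) \<longlongrightarrow> 1 / \<psi> p) at_top"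
proof -
  have \<psi>: "\<psi> p > 0" using \<psi>_pos p by simp
  have small: "\<forall>\<^sub>F \<epsilon> in at_right 0. 0 < \<epsilon> \<and> \<epsilon> < \<psi> p"
    using eventually_at_right_real[OF \<psi>] by simp
  show ?thesis
  proof (rule order_tendstoI)
    fix l assume "l < 1 / \<psi> p"
    moreover have "((\<lambda>\<epsilon>. 1 / (\<psi> p + \<epsilon>)) \<longlongrightarrow> 1 / (\<psi> p + 0)) (at_right 0)"
      using \<psi> by (intro tendsto_intros) auto
    ultimately have "\<forall>\<^sub>F \<epsilon> in at_right 0. l < 1 / (\<psi> p + \<epsilon>)"
      by (intro order_tendstoD) auto
    with small have "\<forall>\<^sub>F \<epsilon> in at_right 0. (0 < \<epsilon> \<and> \<epsilon> < \<psi> p) \<and> l < 1 / (\<psi> p + \<epsilon>)"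
      by (rule eventually_conj)
    then obtain \<epsilon> where \<epsilon>: "0 < \<epsilon>" "\<epsilon> < \<psi> p" "l < 1 / (\<psi> p + \<epsilon>)"
      using eventually_happens'[OF trivial_limit_at_right_real] by blast
    obtain c where c: "c > 0"
      "\<forall>\<^sub>F \<alpha> in at_top. (1 - exp (- \<gamma> \<alpha> * c)) / (\<psi> p + \<epsilon>) \<le> \<gamma> \<alpha> * u_fun (g \<alpha>) (s \<alpha>) * g \<alpha> (s \<alpha>) \<and>
       \<gamma> \<alpha> * u_fun (g \<alpha>) (s \<alpha>) * g \<alpha> (s \<alpha>) \<le> 1 / (\<psi> p - \<epsilon>) + \<gamma> \<alpha> * exp (- \<gamma> \<alpha> * c)"
      by (rule \<gamma>_u_g_bounds[OF p s \<epsilon>(1,2)])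
    have "((\<lambda>\<alpha>. (1 - exp (- \<gamma> \<alpha> * c)) / (\<psi> p + \<epsilon>)) \<longlongrightarrow> (1 - 0) / (\<psi> p + \<epsilon>)) at_top"
      using \<psi> \<epsilon> by (intro tendsto_divide tendsto_diff tendsto_const exp_\<gamma>_tendsto_0 c) auto
    then have "\<forall>\<^sub>F \<alpha> in at_top. l < (1 - exp (- \<gamma> \<alpha> * c)) / (\<psi> p + \<epsilon>)"
      using \<epsilon> by (intro order_tendstoD) auto
    with c(2) show "\<forall>\<^sub>F \<alpha> in at_top. l < \<gamma> \<alpha> * u_fun (g \<alpha>) (s \<alpha>) * g \<alpha> (s \<alpha>)"
      by eventually_elim linarith
  next
    fix l assume "1 / \<psi> p < l"
    moreover have "((\<lambda>\<epsilon>. 1 / (\<psi> p - \<epsilon>)) \<longlongrightarrow> 1 / (\<psi> p - 0)) (at_right 0)"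
      using \<psi> by (intro tendsto_intros) auto
    ultimately have "\<forall>\<^sub>F \<epsilon> in at_right 0. 1 / (\<psi> p - \<epsilon>) < l"
      by (intro order_tendstoD) auto
    with small have "\<forall>\<^sub>F \<epsilon> in at_right 0. (0 < \<epsilon> \<and> \<epsilon> < \<psi> p) \<and> 1 / (\<psi> p - \<epsilon>) < l"
      by (rule eventually_conj)
    then obtain \<epsilon> where \<epsilon>: "0 < \<epsilon>" "\<epsilon> < \<psi> p" "1 / (\<psi> p - \<epsilon>) < l"
      using eventually_happens'[OF trivial_limit_at_right_real] by blast
    obtain c where c: "c > 0"
      "\<forall>\<^sub>F \<alpha> in at_top. (1 - exp (- \<gamma> \<alpha> * c)) / (\<psi> p + \<epsilon>) \<le> \<gamma> \<alpha> * u_fun (g \<alpha>) (s \<alpha>) * g \<alpha> (s \<alpha>) \<and>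
       \<gamma> \<alpha> * u_fun (g \<alpha>) (s \<alpha>) * g \<alpha> (s \<alpha>) \<le> 1 / (\<psi> p - \<epsilon>) + \<gamma> \<alpha> * exp (- \<gamma> \<alpha> * c)"
      by (rule \<gamma>_u_g_bounds[OF p s \<epsilon>(1,2)])
    have "((\<lambda>\<alpha>. 1 / (\<psi> p - \<epsilon>) + \<gamma> \<alpha> * exp (- \<gamma> \<alpha> * c)) \<longlongrightarrow> 1 / (\<psi> p - \<epsilon>) + 0) at_top"
      by (intro tendsto_add tendsto_const exp_\<gamma>_tendsto_0 c)
    then have "\<forall>\<^sub>F \<alpha> in at_top. 1 / (\<psi> p - \<epsilon>) + \<gamma> \<alpha> * exp (- \<gamma> \<alpha> * c) < l"
      using \<epsilon> by (intro order_tendstoD) auto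
    with c(2) show "\<forall>\<^sub>F \<alpha> in at_top. \<gamma> \<alpha> * u_fun (g \<alpha>) (s \<alpha>) * g \<alpha> (s \<alpha>) < l"
      by eventually_elim linarith
  qed
qed

text \<open>\<open>V\<close> is at least x, so only V \<le> p + d is at stake, that is u(x) + u(y)
  \<le> u(p + d). With p < q < m < p + d the left side is at most 2/g(q), the right side at least
  (d/2)/g(m), and g(m) is exponentially smaller than g(q).\<close>

lemma V_tendsto:
  assumes p: "0 < p" "p < 1" and x: "(x \<longlongrightarrow> p) at_top" and y: "(y \<longlongrightarrow> p) at_top"
  shows "((\<lambda>\<alpha>. V_fun (g \<alpha>) (x \<alpha>) (y \<alpha>)) \<longlongrightarrow> p) at_top"
proof (rule tendstoI)
  fix e :: real assume "e > 0"
  have \<psi>: "\<psi> p > 0" using \<psi>_pos p by simp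
  then obtain \<delta> where \<delta>: "\<delta> > 0" "\<delta> < p" "p + \<delta> < 1"
    "\<forall>\<^sub>F \<alpha> in at_top. \<forall>s. \<bar>s - p\<bar> \<le> \<delta> \<longrightarrow> \<bar>\<phi> \<alpha> s - \<psi> p\<bar> < \<psi> p / 2"
    using \<phi>_near[OF p, of "\<psi> p / 2"] by auto
  define d where "d = min (e / 2) \<delta>"
  have d: "d > 0" "d < e" "d \<le> \<delta>" using \<open>e > 0\<close> \<delta> by (auto simp: d_def)
  \<comment> \<open>Eventually x and y lie below \<open>q\<close>; \<open>g\<close> decays across
    the gap from \<open>q\<close> to \<open>m\<close>; the stretch of length d/2 beyond
    \<open>m\<close> provides the lower bound for u(p + d).\<close>
  define q where "q = p + d / 4"
  define m where "m = p + d / 2"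
  have qm: "0 < q" "q < m" "m < p + d" "p + d < 1" "m - q = d / 4" 
    using p d \<delta> by (auto simp: q_def m_def)
  have d4: "d / 4 > 0" using d by simp
  have "((\<lambda>\<alpha>. exp (- \<gamma> \<alpha> * (\<psi> p / 2 * (m - q)))) \<longlongrightarrow> 0) at_top"
    by (rule exp_\<gamma>_tendsto_0) (use \<psi> qm in auto)
  \<comment> \<open>The threshold d/4 for g(m)/g(q) is exactly what makes 2/g(q) \<le>
    (d/2)/g(m).\<close>
  then have "\<forall>\<^sub>F \<alpha> in at_top. exp (- \<gamma> \<alpha> * (\<psi> p / 2 * (m - q))) < d / 4"
    using d by (intro order_tendstoD) auto
  then show "\<forall>\<^sub>F \<alpha> in at_top. dist (V_fun (g \<alpha>) (x \<alpha>) (y \<alpha>)) p < e"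
    using \<delta>(4) eventually_ge_1 tendsto_eventually_near[OF x d4] tendsto_eventually_near[OF y d4]
  proof eventually_elim
    case (elim \<alpha>)
    interpret admissible_function "g \<alpha>" using elim admissible by blast
    have xy: "0 < x \<alpha>" "x \<alpha> \<le> q" "0 < y \<alpha>" "y \<alpha> \<le> q" "p - d < x \<alpha>" "x \<alpha> < 1" "y \<alpha> < 1"
      using elim(4,5) d \<delta> qm unfolding q_def by linarith+
    have uq: "u z \<le> 1 / g \<alpha> q" if "0 < z" "z \<le> q" for z
    proof -
      have "u z \<le> u q" using that qm by (intro u_le) auto
      also have "\<dots> \<le> q / g \<alpha> q" using u_diff_bounds(2)[of 0 q] u_0 qm by simp
      also have "\<dots> \<le> 1 / g \<alpha> q" using qm g_pos[of q] by (intro divide_right_mono) auto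
      finally show ?thesis .
    qed
    have "g \<alpha> m / g \<alpha> q \<le> exp (- \<gamma> \<alpha> * (\<psi> p / 2 * (m - q)))"
    proof (rule g_decay)
      fix s assume "q < s" "s < m"
      then have "\<bar>s - p\<bar> \<le> \<delta>" using d by (auto simp: q_def m_def)
      then have "\<bar>\<phi> \<alpha> s - \<psi> p\<bar> < \<psi> p / 2" using elim(2) by blast
      then show "\<psi> p / 2 \<le> \<phi> \<alpha> s" by linarith
    qed (use qm elim in auto)
    also have "\<dots> \<le> d / 4" using elim(1) by simp
    finally have "2 / g \<alpha> q \<le> (d / 2) / g \<alpha> m"
      using g_pos[of m] g_pos[of q] qm by (simp add: field_simps)
    moreover have "(d / 2) / g \<alpha> m \<le> u (p + d) - u m"
      using u_diff_bounds(1)[of m "p + d"] qm by (simp add: m_def)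
    moreover have "0 \<le> u m" using qm by (intro u_nonneg) auto
    ultimately have "u (x \<alpha>) + u (y \<alpha>) \<le> u (p + d)"
      using uq[of "x \<alpha>"] uq[of "y \<alpha>"] xy by simp
    then have "u (V (x \<alpha>) (y \<alpha>)) \<le> u (p + d)" using xy by (simp add: u_V)
    moreover have V: "x \<alpha> \<le> V (x \<alpha>) (y \<alpha>)" "V (x \<alpha>) (y \<alpha>) < 1"
      using xy by (auto intro!: V_ge V_less_1)
    ultimately have "V (x \<alpha>) (y \<alpha>) \<le> p + d"
      using u_le_iff[of "V (x \<alpha>) (y \<alpha>)" "p + d"] xy qm p d by auto
    then show ?case using V xy d by (auto simp: dist_real_def)
  qed
qed

section \<open>Densities in the rescaled coordinates and their pointwise limit\<close>

text \<open>The factor 2/\<gamma> is the absolute Jacobian determinant of the map from (p, v) to (p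
  + v/\<gamma>, p - v/\<gamma>).\<close>

definition scaled_density :: "real \<Rightarrow> real \<times> real \<Rightarrow> real" where
  "scaled_density \<alpha> p = 2 / \<gamma> \<alpha> * permuton_density (g \<alpha>) (fst p + snd p / \<gamma> \<alpha>, fst p - snd p / \<gamma> \<alpha>)"

text \<open>Given U = p, the variable L/\<psi>(p) has density \<psi>(p) l(\<psi>(p) v), where l is
  the density of L.\<close>

definition limit_density :: "real \<times> real \<Rightarrow> real" where
  "limit_density p = indicator {0<..<1} (fst p) *
     (2 * \<psi> (fst p) / (exp (\<psi> (fst p) * snd p) + exp (- (\<psi> (fst p) * snd p)))\<^sup>2)"

text \<open>The two original coordinates add up to 2a, so for a outside [0,1] they cannot both lie
  in (0,1).\<close>

lemma scaled_density_eq_0: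
  assumes "a < 0 \<or> 1 < a" "\<alpha> \<ge> 1"
  shows "scaled_density \<alpha> (a, b) = 0"
proof -
  have "\<not> (0 < a + b / \<gamma> \<alpha> \<and> a + b / \<gamma> \<alpha> < 1 \<and> 0 < a - b / \<gamma> \<alpha> \<and> a - b / \<gamma> \<alpha> < 1)"
    using assms by linarith
  then show ?thesis
    using admissible_function.dens_eq_0[OF admissible[OF assms(2)]] by (simp add: scaled_density_def)
qed

text \<open>With r = \<gamma> u g, the relation u(W) = u(x) + u(y) gives the exact identity
  g(x)/g(W) = (r(x) + r(y) g(x)/g(y))/r(W), and the same with x and y exchanged. This rewrites the
  density, for large \<alpha>, in terms of quantities whose limits are known.\<close>

lemma scaled_density_tendsto:
  assumes p: "0 < p" "p < 1"
  shows "((\<lambda>\<alpha>. scaled_density \<alpha> (p, v)) \<longlongrightarrow> limit_density (p, v)) at_top"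
proof -
  have \<psi>: "\<psi> p > 0" using \<psi>_pos p by simp
  define x where "x = (\<lambda>\<alpha>. p + v / \<gamma> \<alpha>)"
  define y where "y = (\<lambda>\<alpha>. p - v / \<gamma> \<alpha>)"
  define W where "W = (\<lambda>\<alpha>. V_fun (g \<alpha>) (x \<alpha>) (y \<alpha>))"
  define r where "r = (\<lambda>z \<alpha>. \<gamma> \<alpha> * u_fun (g \<alpha>) (z \<alpha>) * g \<alpha> (z \<alpha>))"
  have v: "((\<lambda>\<alpha>. v / \<gamma> \<alpha>) \<longlongrightarrow> 0) at_top"
    by (rule real_tendsto_divide_at_top[OF tendsto_const \<gamma>_at_top])
  have x: "(x \<longlongrightarrow> p) at_top" using tendsto_add[OF tendsto_const v, of p] by (simp add: x_def)
  have y: "(y \<longlongrightarrow> p) at_top" using tendsto_diff[OF tendsto_const v, of p] by (simp add: y_def)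
  have W: "(W \<longlongrightarrow> p) at_top" unfolding W_def by (rule V_tendsto[OF p x y])
  define \<rho> where "\<rho> = min p (1 - p)"
  have \<rho>: "\<rho> > 0" "\<rho> \<le> p" "\<rho> \<le> 1 - p" using p by (auto simp: \<rho>_def)
  have near: "\<forall>\<^sub>F \<alpha> in at_top. \<alpha> \<ge> 1 \<and> 0 < x \<alpha> \<and> x \<alpha> < 1 \<and> 0 < y \<alpha> \<and> y \<alpha> < 1 \<and> 0 < W \<alpha> \<and> W \<alpha> < 1"
    using eventually_ge_1 tendsto_eventually_near[OF x \<rho>(1)] tendsto_eventually_near[OF y \<rho>(1)]
      tendsto_eventually_near[OF W \<rho>(1)]
    by eventually_elim (use \<rho> in auto)
  have xy: "((\<lambda>\<alpha>. g \<alpha> (x \<alpha>) / g \<alpha> (y \<alpha>)) \<longlongrightarrow> exp (- \<psi> p * (2 * v))) at_top"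
  proof (rule g_ratio_tendsto[OF p x y])
    have "\<forall>\<^sub>F \<alpha> in at_top. 2 * v = \<gamma> \<alpha> * (x \<alpha> - y \<alpha>)"
      using eventually_ge_1 by eventually_elim (use \<gamma>_pos in \<open>force simp: x_def y_def field_simps\<close>)
    then show "((\<lambda>\<alpha>. \<gamma> \<alpha> * (x \<alpha> - y \<alpha>)) \<longlongrightarrow> 2 * v) at_top"
      by (rule Lim_transform_eventually[OF tendsto_const])
  qed
  have yx: "((\<lambda>\<alpha>. g \<alpha> (y \<alpha>) / g \<alpha> (x \<alpha>)) \<longlongrightarrow> exp (\<psi> p * (2 * v))) at_top"
    using tendsto_inverse[OF xy] by (simp add: exp_minus)
  have r: "(r x \<longlongrightarrow> 1 / \<psi> p) at_top" "(r y \<longlongrightarrow> 1 / \<psi> p) at_top" "(r W \<longlongrightarrow> 1 / \<psi> p) at_top"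
    unfolding r_def by (rule \<gamma>_u_g_tendsto[OF p x] \<gamma>_u_g_tendsto[OF p y] \<gamma>_u_g_tendsto[OF p W])+
  have lim: "((\<lambda>\<alpha>. 2 * \<phi> \<alpha> (W \<alpha>) / (((r x \<alpha> + r y \<alpha> * (g \<alpha> (x \<alpha>) / g \<alpha> (y \<alpha>))) / r W \<alpha>) *
      ((r y \<alpha> + r x \<alpha> * (g \<alpha> (y \<alpha>) / g \<alpha> (x \<alpha>))) / r W \<alpha>))) \<longlongrightarrow>
    2 * \<psi> p / (((1 / \<psi> p + 1 / \<psi> p * exp (- \<psi> p * (2 * v))) / (1 / \<psi> p)) *
      ((1 / \<psi> p + 1 / \<psi> p * exp (\<psi> p * (2 * v))) / (1 / \<psi> p)))) at_top"
    using \<psi> by (intro tendsto_divide tendsto_mult tendsto_add tendsto_const xy yx r tendsto_\<phi>[OF p W])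
      (auto simp: add_pos_pos less_imp_neq[THEN not_sym])
  have "2 * \<psi> p / (((1 / \<psi> p + 1 / \<psi> p * exp (- \<psi> p * (2 * v))) / (1 / \<psi> p)) *
      ((1 / \<psi> p + 1 / \<psi> p * exp (\<psi> p * (2 * v))) / (1 / \<psi> p))) = limit_density (p, v)"
  proof -
    \<comment> \<open>The limit of the denominator is (1 + 1/E^2) (1 + E^2), which is the square of
      E + 1/E.\<close>
    define E where "E = exp (\<psi> p * v)"
    have E: "E > 0" "exp (- (\<psi> p * v)) = 1 / E" "exp (- \<psi> p * (2 * v)) = 1 / E ^ 2" "exp (\<psi> p * (2 * v)) = E ^ 2"
      by (simp_all add: E_def exp_minus field_simps flip: exp_double exp_add)
    have "limit_density (p, v) = 2 * \<psi> p / (E + 1 / E)\<^sup>2"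
      using p by (simp add: limit_density_def E flip: E_def)
    moreover have "((1 / \<psi> p + 1 / \<psi> p * (1 / E ^ 2)) / (1 / \<psi> p)) * ((1 / \<psi> p + 1 / \<psi> p * E ^ 2) / (1 / \<psi> p)) = (E + 1 / E)\<^sup>2"
      using \<psi> E(1) by (simp add: field_simps power2_eq_square)
    ultimately show ?thesis by (simp only: E(3,4))
  qed
  moreover have "\<forall>\<^sub>F \<alpha> in at_top. 2 * \<phi> \<alpha> (W \<alpha>) / (((r x \<alpha> + r y \<alpha> * (g \<alpha> (x \<alpha>) / g \<alpha> (y \<alpha>))) / r W \<alpha>) *
      ((r y \<alpha> + r x \<alpha> * (g \<alpha> (y \<alpha>) / g \<alpha> (x \<alpha>))) / r W \<alpha>)) = scaled_density \<alpha> (p, v)"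
    using near
  proof eventually_elim
    case (elim \<alpha>)
    interpret admissible_function "g \<alpha>" using elim admissible by blast
    have \<gamma>: "\<gamma> \<alpha> > 0" using \<gamma>_pos elim by simp
    have pos: "g \<alpha> (x \<alpha>) > 0" "g \<alpha> (y \<alpha>) > 0" "g \<alpha> (W \<alpha>) > 0" "u (x \<alpha>) > 0" "u (y \<alpha>) > 0"
      using elim by (auto intro!: g_pos u_pos)
    have uW: "u (W \<alpha>) = u (x \<alpha>) + u (y \<alpha>)" unfolding W_def using elim by (intro u_V) auto
    define A where "A = u (x \<alpha>) + u (y \<alpha>)"
    have A: "A > 0" using pos by (simp add: A_def)
    have 1: "(r x \<alpha> + r y \<alpha> * (g \<alpha> (x \<alpha>) / g \<alpha> (y \<alpha>))) / r W \<alpha> = g \<alpha> (x \<alpha>) / g \<alpha> (W \<alpha>)"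
    proof -
      have "r x \<alpha> + r y \<alpha> * (g \<alpha> (x \<alpha>) / g \<alpha> (y \<alpha>)) = \<gamma> \<alpha> * A * g \<alpha> (x \<alpha>)"
        using pos by (simp add: r_def A_def algebra_simps)
      moreover have "r W \<alpha> = \<gamma> \<alpha> * A * g \<alpha> (W \<alpha>)" by (simp add: r_def uW A_def)
      ultimately show ?thesis using A \<gamma> by simp
    qed
    have 2: "(r y \<alpha> + r x \<alpha> * (g \<alpha> (y \<alpha>) / g \<alpha> (x \<alpha>))) / r W \<alpha> = g \<alpha> (y \<alpha>) / g \<alpha> (W \<alpha>)"
    proof -
      have "r y \<alpha> + r x \<alpha> * (g \<alpha> (y \<alpha>) / g \<alpha> (x \<alpha>)) = \<gamma> \<alpha> * A * g \<alpha> (y \<alpha>)"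
        using pos by (simp add: r_def A_def algebra_simps)
      moreover have "r W \<alpha> = \<gamma> \<alpha> * A * g \<alpha> (W \<alpha>)" by (simp add: r_def uW A_def)
      ultimately show ?thesis using A \<gamma> by simp
    qed
    have "dens (x \<alpha>, y \<alpha>) = - g' (W \<alpha>) * g \<alpha> (W \<alpha>) / (g \<alpha> (x \<alpha>) * g \<alpha> (y \<alpha>))"
      unfolding W_def using elim by (intro dens_eq) auto
    also have "\<dots> = \<gamma> \<alpha> * \<phi> \<alpha> (W \<alpha>) * g \<alpha> (W \<alpha>) * g \<alpha> (W \<alpha>) / (g \<alpha> (x \<alpha>) * g \<alpha> (y \<alpha>))"
      using elim by (simp add: deriv_g)
    finally have "scaled_density \<alpha> (p, v) = 2 / \<gamma> \<alpha> * (\<gamma> \<alpha> * \<phi> \<alpha> (W \<alpha>) * g \<alpha> (W \<alpha>) * g \<alpha> (W \<alpha>) / (g \<alpha> (x \<alpha>) * g \<alpha> (y \<alpha>)))"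
      by (simp add: scaled_density_def x_def y_def)
    then show ?case unfolding 1 2 using pos \<gamma> by (simp add: field_simps)
  qed
  ultimately show ?thesis
    using Lim_transform_eventually[OF lim] by simp
qed

text \<open>Only the lines with first coordinate 0 or 1 are left out; beyond them both densities
  vanish, between them the pointwise limit applies.\<close>

lemma scaled_density_tendsto_AE:
  "AE p in lborel. ((\<lambda>\<alpha>. scaled_density \<alpha> p) \<longlongrightarrow> limit_density p) at_top"
proof -
  have "{p :: real \<times> real. fst p = c} \<in> null_sets lborel" for c :: real
  proof -
    have "{p :: real \<times> real. fst p = c} = {c} \<times> UNIV" by auto
    moreover have "{c} \<times> (UNIV :: real set) \<in> null_sets (lborel \<Otimes>\<^sub>M lborel)"
      by (auto simp: null_sets_def lborel.emeasure_pair_measure_Times)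
    ultimately show ?thesis by (simp add: lborel_prod)
  qed
  then have "AE p :: real \<times> real in lborel. p \<notin> {p. fst p = 0}" "AE p :: real \<times> real in lborel. p \<notin> {p. fst p = 1}"
    by (blast intro: AE_not_in)+
  then show ?thesis
  proof eventually_elim
    case (elim p)
    obtain a b where p: "p = (a, b)" by force
    show ?case
    proof (cases "0 < a \<and> a < 1")
      case True
      then show ?thesis unfolding p by (intro scaled_density_tendsto) auto
    next
      case False
      then have a: "a < 0 \<or> 1 < a" using elim p by auto
      have "\<forall>\<^sub>F \<alpha> in at_top. 0 = scaled_density \<alpha> p"
        using eventually_ge_1 by eventually_elim (simp add: p scaled_density_eq_0[OF a])
      moreover have "limit_density p = 0" using False by (auto simp: limit_density_def p)
      ultimately show ?thesis by (simp add: Lim_transform_eventually[OF tendsto_const])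
    qed
  qed
qed

end

section \<open>Convergence in distribution\<close>

text \<open>As the masses agree, the \<open>L\<^sup>1\<close> distance of the densities is twice the
  integral of \<open>max 0 (h0 - h \<alpha>)\<close>, which is dominated by \<open>h0\<close>.\<close>

lemma Scheffe_density_tendsto:
  fixes h :: "real \<Rightarrow> 'a \<Rightarrow> real" and h0 f :: "'a \<Rightarrow> real"
  assumes [measurable]: "\<And>\<alpha>. h \<alpha> \<in> borel_measurable M" "h0 \<in> borel_measurable M" "f \<in> borel_measurable M"
    and nonneg: "\<And>\<alpha> x. 0 \<le> h \<alpha> x" "\<And>x. 0 \<le> h0 x"
    and prob: "\<And>\<alpha>. prob_space (density M (\<lambda>x. ennreal (h \<alpha> x)))" "prob_space (density M (\<lambda>x. ennreal (h0 x)))"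
    and lim: "AE x in M. ((\<lambda>\<alpha>. h \<alpha> x) \<longlongrightarrow> h0 x) at_top"
    and bound: "\<And>x. \<bar>f x\<bar> \<le> B"
  shows "((\<lambda>\<alpha>. integral\<^sup>L (density M (\<lambda>x. ennreal (h \<alpha> x))) f) \<longlongrightarrow>
    integral\<^sup>L (density M (\<lambda>x. ennreal (h0 x))) f) at_top"
proof -
  have unit: "integrable M k \<and> integral\<^sup>L M k = 1"
    if [measurable]: "k \<in> borel_measurable M" and "\<And>x. 0 \<le> k x" "prob_space (density M (\<lambda>x. ennreal (k x)))"
    for k :: "'a \<Rightarrow> real"
  proof -
    interpret prob_space "density M (\<lambda>x. ennreal (k x))" by fact
    have "(\<integral>\<^sup>+x. ennreal (k x) \<partial>M) = 1"
      using emeasure_space_1 by (simp add: emeasure_density cong: nn_integral_cong)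
    then show ?thesis using that(2) by (auto simp: nn_integral_eq_integrable[where x = 1, simplified])
  qed
  note h = unit[OF assms(1) nonneg(1) prob(1)] and h0 = unit[OF assms(2) nonneg(2) prob(2)]
  have [simp]: "integrable M (h \<alpha>)" "integrable M h0" "integral\<^sup>L M (h \<alpha>) = 1" "integral\<^sup>L M h0 = 1" for \<alpha>
    using h h0 by auto
  have pos: "integrable M (\<lambda>x. max 0 (h0 x - h \<alpha> x))" for \<alpha>
  proof (rule Bochner_Integration.integrable_bound[of M h0])
    have "norm (max 0 (h0 x - h \<alpha> x)) \<le> norm (h0 x)" for x
      using nonneg(1)[of \<alpha> x] nonneg(2)[of x] by simp
    then show "AE x in M. norm (max 0 (h0 x - h \<alpha> x)) \<le> norm (h0 x)" by simp
  qed simp_all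
  have "((\<lambda>\<alpha>. \<integral>x. max 0 (h0 x - h \<alpha> x) \<partial>M) \<longlongrightarrow> (\<integral>x. 0 \<partial>M)) at_top"
  proof (rule integral_dominated_convergence_at_top[where w = h0])
    show "AE x in M. ((\<lambda>\<alpha>. max 0 (h0 x - h \<alpha> x)) \<longlongrightarrow> 0) at_top"
      using lim
    proof eventually_elim
      case (elim x)
      have "((\<lambda>\<alpha>. max 0 (h0 x - h \<alpha> x)) \<longlongrightarrow> max 0 (h0 x - h0 x)) at_top"
        by (intro tendsto_intros elim)
      then show ?case by simp
    qed
    show "\<forall>\<^sub>F \<alpha> in at_top. AE x in M. norm (max 0 (h0 x - h \<alpha> x)) \<le> h0 x"
      using nonneg by (auto simp: max_def)
  qed simp_all
  then have lim0: "((\<lambda>\<alpha>. B * (2 * (\<integral>x. max 0 (h0 x - h \<alpha> x) \<partial>M))) \<longlongrightarrow> B * (2 * 0)) at_top"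
    by (intro tendsto_intros) simp
  have diff_le: "\<bar>integral\<^sup>L (density M (\<lambda>x. ennreal (h \<alpha> x))) f - integral\<^sup>L (density M (\<lambda>x. ennreal (h0 x))) f\<bar>
      \<le> B * (2 * (\<integral>x. max 0 (h0 x - h \<alpha> x) \<partial>M))" for \<alpha>
  proof -
    have int: "integrable M (\<lambda>x. k x * f x)" if [measurable]: "integrable M k" for k
    proof (rule Bochner_Integration.integrable_bound[of M "\<lambda>x. B * k x"])
      have "norm (k x * f x) \<le> norm (B * k x)" for x
      proof -
        have "\<bar>f x\<bar> \<le> \<bar>B\<bar>" using bound[of x] by linarith
        from mult_left_mono[OF this abs_ge_zero[of "k x"]] show ?thesis
          by (simp add: abs_mult mult.commute)
      qed
      then show "AE x in M. norm (k x * f x) \<le> norm (B * k x)" by simp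
    qed (use that in simp_all)
    have "integral\<^sup>L (density M (\<lambda>x. ennreal (h \<alpha> x))) f - integral\<^sup>L (density M (\<lambda>x. ennreal (h0 x))) f
        = (\<integral>x. (h \<alpha> x - h0 x) * f x \<partial>M)"
      using nonneg int by (simp add: integral_density left_diff_distrib)
    also have "\<bar>\<dots>\<bar> \<le> (\<integral>x. \<bar>(h \<alpha> x - h0 x) * f x\<bar> \<partial>M)"
      by (rule integral_abs_bound)
    also have "\<dots> \<le> (\<integral>x. B * (2 * max 0 (h0 x - h \<alpha> x) + (h \<alpha> x - h0 x)) \<partial>M)"
    proof (rule integral_mono)
      show "integrable M (\<lambda>x. \<bar>(h \<alpha> x - h0 x) * f x\<bar>)" by (intro integrable_abs int) simp
      show "integrable M (\<lambda>x. B * (2 * max 0 (h0 x - h \<alpha> x) + (h \<alpha> x - h0 x)))"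
        using pos by simp
      have *: "2 * max 0 (h0 x - h \<alpha> x) + (h \<alpha> x - h0 x) = \<bar>h \<alpha> x - h0 x\<bar>" for x
        by (simp add: max_def)
      show "\<bar>(h \<alpha> x - h0 x) * f x\<bar> \<le> B * (2 * max 0 (h0 x - h \<alpha> x) + (h \<alpha> x - h0 x))" for x
        unfolding * using bound[of x] by (simp add: abs_mult mult.commute[of B] mult_left_mono)
    qed
    also have "\<dots> = B * (2 * (\<integral>x. max 0 (h0 x - h \<alpha> x) \<partial>M))"
      using pos by simp
    finally show ?thesis .
  qed
  have "((\<lambda>\<alpha>. integral\<^sup>L (density M (\<lambda>x. ennreal (h \<alpha> x))) f -
      integral\<^sup>L (density M (\<lambda>x. ennreal (h0 x))) f) \<longlongrightarrow> 0) at_top"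
  proof (rule Lim_null_comparison)
    show "((\<lambda>\<alpha>. B * (2 * (\<integral>x. max 0 (h0 x - h \<alpha> x) \<partial>M))) \<longlongrightarrow> 0) at_top"
      using lim0 by simp
    show "\<forall>\<^sub>F \<alpha> in at_top. norm (integral\<^sup>L (density M (\<lambda>x. ennreal (h \<alpha> x))) f -
        integral\<^sup>L (density M (\<lambda>x. ennreal (h0 x))) f) \<le> B * (2 * (\<integral>x. max 0 (h0 x - h \<alpha> x) \<partial>M))"
      unfolding real_norm_def by (rule always_eventually) (rule allI, rule diff_le)
  qed
  then show ?thesis by (rule Lim_null[THEN iffD2])
qed

text \<open>Two one-dimensional substitutions replace a planar change of variables: y = 2a - x for
  fixed x contributes the factor 2, and after exchanging the integrals x = a + c b for fixed a
  contributes c.\<close>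

lemma nn_integral_lborel_rotate:
  fixes f :: "real \<times> real \<Rightarrow> ennreal"
  assumes "f \<in> borel_measurable borel" and c: "c > 0"
  shows "(\<integral>\<^sup>+p. f p \<partial>lborel) = (\<integral>\<^sup>+p. ennreal (2 * c) * f (fst p + c * snd p, fst p - c * snd p) \<partial>lborel)"
proof -
  have [measurable]: "f \<in> borel_measurable (borel \<Otimes>\<^sub>M borel)" using assms(1) by (simp add: borel_prod)
  have "(\<integral>\<^sup>+p. f p \<partial>lborel) = (\<integral>\<^sup>+p. f p \<partial>(lborel \<Otimes>\<^sub>M lborel))" by (simp add: lborel_prod)
  also have "\<dots> = (\<integral>\<^sup>+x. \<integral>\<^sup>+y. f (x, y) \<partial>lborel \<partial>lborel)"
    by (rule lborel.nn_integral_fst[symmetric]) measurable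
  also have "\<dots> = (\<integral>\<^sup>+x. \<integral>\<^sup>+a. ennreal 2 * f (x, 2 * a - x) \<partial>lborel \<partial>lborel)"
  proof (rule nn_integral_cong)
    fix x :: real
    have "(\<integral>\<^sup>+y. f (x, y) \<partial>lborel) = ennreal \<bar>2\<bar> * (\<integral>\<^sup>+a. f (x, - x + 2 * a) \<partial>lborel)"
      by (rule nn_integral_real_affine) auto
    also have "\<dots> = (\<integral>\<^sup>+a. ennreal 2 * f (x, 2 * a - x) \<partial>lborel)"
      by (subst nn_integral_cmult) (auto simp: algebra_simps)
    finally show "(\<integral>\<^sup>+y. f (x, y) \<partial>lborel) = \<dots>" .
  qed
  also have "\<dots> = (\<integral>\<^sup>+a. \<integral>\<^sup>+x. ennreal 2 * f (x, 2 * a - x) \<partial>lborel \<partial>lborel)"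
    by (rule lborel_pair.Fubini') measurable
  also have "\<dots> = (\<integral>\<^sup>+a. \<integral>\<^sup>+b. ennreal (2 * c) * f (a + c * b, a - c * b) \<partial>lborel \<partial>lborel)"
  proof (rule nn_integral_cong)
    fix a :: real
    have "(\<integral>\<^sup>+x. ennreal 2 * f (x, 2 * a - x) \<partial>lborel) =
        ennreal \<bar>c\<bar> * (\<integral>\<^sup>+b. ennreal 2 * f (a + c * b, 2 * a - (a + c * b)) \<partial>lborel)"
      using c by (intro nn_integral_real_affine) auto
    also have "\<dots> = (\<integral>\<^sup>+b. ennreal \<bar>c\<bar> * (ennreal 2 * f (a + c * b, 2 * a - (a + c * b))) \<partial>lborel)"
      by (rule nn_integral_cmult[symmetric]) measurable
    also have "\<dots> = (\<integral>\<^sup>+b. ennreal (2 * c) * f (a + c * b, a - c * b) \<partial>lborel)"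
      using c by (intro nn_integral_cong) (simp add: mult_ac ennreal_mult)
    finally show "(\<integral>\<^sup>+x. ennreal 2 * f (x, 2 * a - x) \<partial>lborel) = \<dots>" .
  qed
  also have "\<dots> = (\<integral>\<^sup>+p. ennreal (2 * c) * f (fst p + c * snd p, fst p - c * snd p) \<partial>(lborel \<Otimes>\<^sub>M lborel))"
    by (subst lborel.nn_integral_fst[symmetric]) auto
  finally show ?thesis by (simp add: lborel_prod)
qed

lemma borel_measurable_rescale:
  "(\<lambda>p :: real \<times> real. ((fst p + snd p) / 2, c * ((fst p - snd p) / 2))) \<in> borel_measurable borel"
  by (intro borel_measurable_continuous_onI continuous_intros) auto

context scaled_family begin

section \<open>The law of the rescaled vector\<close>

lemma scaled_density_nonneg: "\<alpha> \<ge> 1 \<Longrightarrow> 0 \<le> scaled_density \<alpha> p"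
  using admissible_function.dens_nonneg[OF admissible] \<gamma>_pos[of \<alpha>] by (simp add: scaled_density_def)

lemma borel_measurable_scaled_density:
  assumes "\<alpha> \<ge> 1"
  shows "scaled_density \<alpha> \<in> borel_measurable borel"
proof -
  interpret admissible_function "g \<alpha>" using assms by (rule admissible)
  have "scaled_density \<alpha> \<in> borel_measurable (borel \<Otimes>\<^sub>M borel)"
    unfolding scaled_density_def[abs_def] by measurable
  then show ?thesis by (simp add: borel_prod)
qed

lemma distr_permuton_of:
  assumes \<alpha>: "\<alpha> \<ge> 1"
  shows "distr (permuton_of (g \<alpha>)) borel (\<lambda>p. ((fst p + snd p) / 2, \<gamma> \<alpha> * ((fst p - snd p) / 2))) =
    density lborel (\<lambda>p. ennreal (scaled_density \<alpha> p))" (is "distr _ _ ?T = _")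
proof (rule measure_eqI)
  interpret admissible_function "g \<alpha>" using \<alpha> by (rule admissible)
  have \<gamma>: "\<gamma> \<alpha> > 0" using \<gamma>_pos \<alpha> .
  have dens [measurable]: "dens \<in> borel_measurable borel" by (rule borel_measurable_dens)
  note T [measurable] = borel_measurable_rescale[of "\<gamma> \<alpha>"]
  fix A assume "A \<in> sets (distr (permuton_of (g \<alpha>)) borel ?T)"
  then have A [measurable]: "A \<in> sets borel" by simp
  have "emeasure (distr (permuton_of (g \<alpha>)) borel ?T) A = emeasure (density lborel (\<lambda>p. ennreal (dens p))) (?T -` A)"
    unfolding permuton_of_eq using T by (subst emeasure_distr) auto
  also have "\<dots> = (\<integral>\<^sup>+p. ennreal (dens p) * indicator A (?T p) \<partial>lborel)"
    using measurable_sets_borel[OF T A] by (subst emeasure_density) (auto intro!: nn_integral_cong simp: indicator_def)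
  \<comment> \<open>With c = 1/\<gamma> the substitution inverts \<open>?T\<close>, so the indicator
    is evaluated at q itself, and 2c times the density becomes
    \<open>scaled_density\<close>.\<close>
  also have "\<dots> = (\<integral>\<^sup>+q. ennreal (2 * (1 / \<gamma> \<alpha>)) *
      (ennreal (dens (fst q + 1 / \<gamma> \<alpha> * snd q, fst q - 1 / \<gamma> \<alpha> * snd q)) *
       indicator A (?T (fst q + 1 / \<gamma> \<alpha> * snd q, fst q - 1 / \<gamma> \<alpha> * snd q))) \<partial>lborel)"
    by (rule nn_integral_lborel_rotate) (use \<gamma> in \<open>measurable, simp\<close>)
  also have "\<dots> = (\<integral>\<^sup>+q. ennreal (scaled_density \<alpha> q) * indicator A q \<partial>lborel)"
    using \<gamma> dens_nonneg
    by (intro nn_integral_cong) (simp add: scaled_density_def flip: ennreal_mult' mult.assoc)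
  also have "\<dots> = emeasure (density lborel (\<lambda>p. ennreal (scaled_density \<alpha> p))) A"
    using borel_measurable_scaled_density[OF \<alpha>] by (subst emeasure_density) auto
  finally show "emeasure (distr (permuton_of (g \<alpha>)) borel ?T) A = \<dots>" .
qed simp

section \<open>Measurability of the limit function\<close>

lemma continuous_on_\<phi>:
  assumes "\<alpha> \<ge> 1" "b < 1"
  shows "continuous_on {0..b} (\<phi> \<alpha>)"
proof -
  interpret admissible_function "g \<alpha>" using assms(1) by (rule admissible)
  have "\<forall>s\<in>{0..b}. g \<alpha> s \<noteq> 0" using g_pos assms by force
  then show ?thesis
    unfolding psi_scaled_def using assms
    by (intro continuous_intros continuous_on_subset[OF continuous_on_g] continuous_on_subset[OF continuous_on_g']) auto
qed

text \<open>Locally uniform limits of continuous functions are continuous; the measurability of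
  everything built from \<psi> rests on this.\<close>

lemma continuous_on_\<psi>: "continuous_on {0<..<1} \<psi>"
proof (rule continuous_at_imp_continuous_on, rule ballI)
  fix s :: real assume s: "s \<in> {0<..<1}"
  define b where "b = (s + 1) / 2"
  have b: "s < b" "b < 1" using s by (auto simp: b_def)
  have "continuous_on {0..b} \<psi>"
  proof (rule uniform_limit_theorem)
    show "\<forall>\<^sub>F \<alpha> in at_top. continuous_on {0..b} (\<phi> \<alpha>)"
      using eventually_ge_1 by eventually_elim (use continuous_on_\<phi> b in auto)
    show "uniform_limit {0..b} \<phi> \<psi> at_top" using \<phi>_uniform_limit s b by auto
  qed simp
  then show "isCont \<psi> s" using s b by (intro continuous_on_interior) auto
qed

text \<open>The values of \<psi> outside [0,1) are arbitrary, so \<psi> need not be Borel, but this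
  cut-off is. It also drops the point 0, which has to be treated separately or as a null
  set.\<close>

definition \<psi>1 :: "real \<Rightarrow> real" where
  "\<psi>1 s = indicator {0<..<1} s *\<^sub>R \<psi> s"

lemma borel_measurable_\<psi>1 [measurable]: "\<psi>1 \<in> borel_measurable borel"
  unfolding \<psi>1_def[abs_def]
  by (rule borel_measurable_continuous_on_indicator[OF _ continuous_on_\<psi>]) simp

lemma limit_density_nonneg: "0 \<le> limit_density p"
  using \<psi>_pos[of "fst p"] by (auto simp: limit_density_def indicator_def)

lemma borel_measurable_limit_density: "limit_density \<in> borel_measurable borel"
proof -
  have "limit_density = (\<lambda>p. indicator {0<..<1} (fst p) *
     (2 * \<psi>1 (fst p) / (exp (\<psi>1 (fst p) * snd p) + exp (- (\<psi>1 (fst p) * snd p)))\<^sup>2))"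
    by (auto simp: limit_density_def \<psi>1_def indicator_def fun_eq_iff)
  also have "\<dots> \<in> borel_measurable (borel \<Otimes>\<^sub>M borel)" by measurable
  finally show ?thesis by (simp add: borel_prod)
qed

lemma borel_measurable_scaled_by_inverse:
  assumes [measurable]: "U \<in> borel_measurable N" "L \<in> borel_measurable N"
  shows "(\<lambda>\<omega>. scaled_by_inverse \<psi> (U \<omega>) (L \<omega>)) \<in> borel_measurable N"
proof -
  \<comment> \<open>\<open>\<psi>1\<close> vanishes at 0 while \<open>scaled_by_inverse\<close> uses
    \<open>\<psi> 0\<close> there, so 0 gets a branch of its own with a constant factor.\<close>
  have "(\<lambda>\<omega>. scaled_by_inverse \<psi> (U \<omega>) (L \<omega>)) =
      (\<lambda>\<omega>. if U \<omega> = 0 then 1 / \<psi> 0 * L \<omega> else if U \<omega> \<in> {0<..<1} then 1 / \<psi>1 (U \<omega>) * L \<omega> else 0)"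
    by (auto simp: scaled_by_inverse_def \<psi>1_def fun_eq_iff)
  also have "\<dots> \<in> borel_measurable N" by measurable
  finally show ?thesis .
qed

text \<open>Independence makes the law of (U, L) a product, hence the image law an iterated
  integral. For fixed a, the substitution t = \<psi>(a) b undoes the scaling and contributes the
  factor \<psi>(a).\<close>

lemma distr_scaled_by_inverse:
  assumes N: "prob_space N" and U: "U \<in> borel_measurable N"
    and U_distr: "distr N lborel U = uniform_measure lborel {0..1}"
    and L: "distributed N lborel L (\<lambda>t. ennreal (2 / (exp t + exp (- t))\<^sup>2))"
    and indep: "prob_space.indep_var N borel U borel L"
  shows "distr N borel (\<lambda>\<omega>. (U \<omega>, scaled_by_inverse \<psi> (U \<omega>) (L \<omega>))) =
    density lborel (\<lambda>p. ennreal (limit_density p))"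
proof (rule measure_eqI)
  interpret N: prob_space N by fact
  note [measurable] = U
  have [measurable]: "L \<in> borel_measurable N" using L by (simp add: distributed_def)
  define l where "l = (\<lambda>t :: real. 2 / (exp t + exp (- t))\<^sup>2)"
  have [measurable]: "l \<in> borel_measurable borel" unfolding l_def by measurable
  have DL: "distr N borel L = density lborel (\<lambda>t. ennreal (l t))"
    using L by (simp add: distributed_def l_def cong: distr_cong)
  have DU: "distr N borel U = density lborel (\<lambda>t. indicator {0<..<1} t)"
  proof -
    have "distr N borel U = distr N lborel U" by (rule distr_cong) auto
    also have "\<dots> = density lborel (\<lambda>t. indicator {0..1} t)"
      unfolding U_distr uniform_measure_def by (simp add: divide_ennreal_def)
    also have "\<dots> = density lborel (\<lambda>t. indicator {0<..<1} t)"
    proof (rule density_cong)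
      have "AE x in lborel. x \<noteq> (0::real)" "AE x in lborel. x \<noteq> (1::real)" by (rule AE_lborel_singleton)+
      then show "AE x in lborel. (indicator {0..1} x :: ennreal) = indicator {0<..<1} (x :: real)"
        by eventually_elim (auto simp: indicator_def)
    qed auto
    finally show ?thesis .
  qed
  have joint: "distr N (borel \<Otimes>\<^sub>M borel) (\<lambda>\<omega>. (U \<omega>, L \<omega>)) = distr N borel U \<Otimes>\<^sub>M distr N borel L"
    using indep by (simp add: N.indep_var_distribution_eq)
  \<comment> \<open>A measurable stand-in for the map from (u, l) to
    \<open>(u, scaled_by_inverse \<psi> u l)\<close>; the two can differ only at u = 0, a null event
    for \<open>U\<close>.\<close>
  define S where "S = (\<lambda>p :: real \<times> real. (fst p, if fst p \<in> {0<..<1} then 1 / \<psi>1 (fst p) * snd p else 0))"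
  have S [measurable]: "S \<in> borel \<Otimes>\<^sub>M borel \<rightarrow>\<^sub>M borel \<Otimes>\<^sub>M borel"
    unfolding S_def by measurable
  have AE_U: "AE \<omega> in N. U \<omega> \<noteq> 0"
  proof -
    have "AE x in distr N borel U. x \<noteq> 0" unfolding DU by (subst AE_density) (auto simp: indicator_def)
    then show ?thesis by (subst (asm) AE_distr_iff) auto
  qed
  have meas: "(\<lambda>\<omega>. (U \<omega>, scaled_by_inverse \<psi> (U \<omega>) (L \<omega>))) \<in> borel_measurable N"
    using borel_measurable_Pair[OF U borel_measurable_scaled_by_inverse[OF U \<open>L \<in> borel_measurable N\<close>]] .
  fix A assume "A \<in> sets (distr N borel (\<lambda>\<omega>. (U \<omega>, scaled_by_inverse \<psi> (U \<omega>) (L \<omega>))))"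
  then have A: "A \<in> sets borel" by simp
  then have A' [measurable]: "A \<in> sets (borel \<Otimes>\<^sub>M borel)" by (simp only: borel_prod)
  have "emeasure (distr N borel (\<lambda>\<omega>. (U \<omega>, scaled_by_inverse \<psi> (U \<omega>) (L \<omega>)))) A =
      (\<integral>\<^sup>+\<omega>. indicator A (U \<omega>, scaled_by_inverse \<psi> (U \<omega>) (L \<omega>)) \<partial>N)"
    using A nn_integral_distr[OF meas, of "indicator A"]
      nn_integral_indicator[of A "distr N borel (\<lambda>\<omega>. (U \<omega>, scaled_by_inverse \<psi> (U \<omega>) (L \<omega>)))"]
    by simp
  also have "\<dots> = (\<integral>\<^sup>+\<omega>. indicator A (S (U \<omega>, L \<omega>)) \<partial>N)"
  proof (rule nn_integral_cong_AE)
    show "AE \<omega> in N. indicator A (U \<omega>, scaled_by_inverse \<psi> (U \<omega>) (L \<omega>)) = (indicator A (S (U \<omega>, L \<omega>)) :: ennreal)"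
      using AE_U by eventually_elim (simp add: S_def scaled_by_inverse_def \<psi>1_def)
  qed
  also have "\<dots> = (\<integral>\<^sup>+p. indicator A (S p) \<partial>(distr N (borel \<Otimes>\<^sub>M borel) (\<lambda>\<omega>. (U \<omega>, L \<omega>))))"
    by (subst nn_integral_distr) auto
  also have "\<dots> = (\<integral>\<^sup>+a. \<integral>\<^sup>+t. indicator A (S (a, t)) \<partial>distr N borel L \<partial>distr N borel U)"
  proof -
    interpret D: prob_space "distr N borel L" by (rule N.prob_space_distr) auto
    show ?thesis unfolding joint by (rule D.nn_integral_fst[symmetric]) measurable
  qed
  also have "\<dots> = (\<integral>\<^sup>+a. indicator {0<..<1} a * (\<integral>\<^sup>+t. ennreal (l t) * indicator A (S (a, t)) \<partial>lborel) \<partial>lborel)"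
  proof -
    have *: "(\<integral>\<^sup>+t. indicator A (S (a, t)) \<partial>distr N borel L) = (\<integral>\<^sup>+t. ennreal (l t) * indicator A (S (a, t)) \<partial>lborel)" for a
      unfolding DL by (rule nn_integral_density) measurable
    show ?thesis unfolding * DU by (rule nn_integral_density) measurable
  qed
  also have "\<dots> = (\<integral>\<^sup>+a. \<integral>\<^sup>+b. ennreal (limit_density (a, b)) * indicator A (a, b) \<partial>lborel \<partial>lborel)"
  proof (rule nn_integral_cong)
    fix a :: real
    show "indicator {0<..<1} a * (\<integral>\<^sup>+t. ennreal (l t) * indicator A (S (a, t)) \<partial>lborel) =
      (\<integral>\<^sup>+b. ennreal (limit_density (a, b)) * indicator A (a, b) \<partial>lborel)"
    proof (cases "0 < a \<and> a < 1")
      case True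
      then have \<psi>: "\<psi> a > 0" by (intro \<psi>_pos) auto
      have "(\<integral>\<^sup>+t. ennreal (l t) * indicator A (S (a, t)) \<partial>lborel) =
          ennreal \<bar>\<psi> a\<bar> * (\<integral>\<^sup>+b. ennreal (l (0 + \<psi> a * b)) * indicator A (S (a, 0 + \<psi> a * b)) \<partial>lborel)"
        using \<psi> by (intro nn_integral_real_affine) auto
      also have "\<dots> = (\<integral>\<^sup>+b. ennreal \<bar>\<psi> a\<bar> * (ennreal (l (0 + \<psi> a * b)) * indicator A (S (a, 0 + \<psi> a * b))) \<partial>lborel)"
        by (rule nn_integral_cmult[symmetric]) measurable
      also have "\<dots> = (\<integral>\<^sup>+b. ennreal (limit_density (a, b)) * indicator A (a, b) \<partial>lborel)"
      proof (rule nn_integral_cong)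
        fix b
        have "S (a, 0 + \<psi> a * b) = (a, b)" using True \<psi> by (simp add: S_def \<psi>1_def)
        moreover have "ennreal (limit_density (a, b)) = ennreal \<bar>\<psi> a\<bar> * ennreal (l (0 + \<psi> a * b))"
          using True \<psi> by (simp add: limit_density_def l_def flip: ennreal_mult')
        ultimately show "ennreal \<bar>\<psi> a\<bar> * (ennreal (l (0 + \<psi> a * b)) * indicator A (S (a, 0 + \<psi> a * b))) =
            ennreal (limit_density (a, b)) * indicator A (a, b)"
          by (simp only: mult.assoc)
      qed
      finally show ?thesis using True by simp
    next
      case False
      then show ?thesis by (auto simp: limit_density_def)
    qed
  qed
  also have "\<dots> = (\<integral>\<^sup>+p. ennreal (limit_density p) * indicator A p \<partial>(lborel \<Otimes>\<^sub>M lborel))"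
    by (intro lborel.nn_integral_fst) (use borel_measurable_limit_density A in \<open>simp add: lborel_prod\<close>)
  also have "\<dots> = emeasure (density lborel (\<lambda>p. ennreal (limit_density p))) A"
    using borel_measurable_limit_density A by (subst emeasure_density) (auto simp: lborel_prod)
  finally show "emeasure (distr N borel (\<lambda>\<omega>. (U \<omega>, scaled_by_inverse \<psi> (U \<omega>) (L \<omega>)))) A = \<dots>" .
qed simp

end

theorem theorem2p14:
  fixes g :: "real \<Rightarrow> real \<Rightarrow> real" and \<gamma> \<psi> :: "real \<Rightarrow> real"
    and M :: "real \<Rightarrow> 'a measure" and X Y :: "real \<Rightarrow> 'a \<Rightarrow> real"
    and N :: "'b measure" and U L :: "'b \<Rightarrow> real"
  assumes "scaled_log_deriv_assumption g \<gamma> \<psi>"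
    and "\<And>\<alpha>. \<alpha> \<ge> 1 \<Longrightarrow> prob_space (M \<alpha>)"
    and "\<And>\<alpha>. \<alpha> \<ge> 1 \<Longrightarrow> X \<alpha> \<in> borel_measurable (M \<alpha>)"
    and "\<And>\<alpha>. \<alpha> \<ge> 1 \<Longrightarrow> Y \<alpha> \<in> borel_measurable (M \<alpha>)"
    and "\<And>\<alpha>. \<alpha> \<ge> 1 \<Longrightarrow> distr (M \<alpha>) borel (\<lambda>\<omega>. (X \<alpha> \<omega>, Y \<alpha> \<omega>)) = permuton_of (g \<alpha>)"
    and "prob_space N"
    and "U \<in> borel_measurable N"
    and "distr N lborel U = uniform_measure lborel {0..1}"
    and "distributed N lborel L (\<lambda>t. ennreal (2 / (exp t + exp (- t))\<^sup>2))"
    and "prob_space.indep_var N borel U borel L"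
  shows "weakly_converges
           (\<lambda>\<alpha>. distr (M \<alpha>) borel
              (\<lambda>\<omega>. ((X \<alpha> \<omega> + Y \<alpha> \<omega>) / 2, \<gamma> \<alpha> * ((X \<alpha> \<omega> - Y \<alpha> \<omega>) / 2))))
           (distr N borel (\<lambda>\<omega>. (U \<omega>, scaled_by_inverse \<psi> (U \<omega>) (L \<omega>))))
           at_top"
proof -
  interpret scaled_family g \<gamma> \<psi> by (rule scaled_family.intro) fact
  let ?T = "\<lambda>\<alpha> p. ((fst p + snd p) / 2, \<gamma> \<alpha> * ((fst p - snd p) / 2)) :: real \<times> real"
  let ?Z = "\<lambda>\<alpha> \<omega>. ((X \<alpha> \<omega> + Y \<alpha> \<omega>) / 2, \<gamma> \<alpha> * ((X \<alpha> \<omega> - Y \<alpha> \<omega>) / 2))"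
  let ?W = "\<lambda>\<omega>. (U \<omega>, scaled_by_inverse \<psi> (U \<omega>) (L \<omega>))"
  note T = borel_measurable_rescale[of "\<gamma> \<alpha>" for \<alpha>]
  have pair: "(\<lambda>\<omega>. (X \<alpha> \<omega>, Y \<alpha> \<omega>)) \<in> borel_measurable (M \<alpha>)" if "\<alpha> \<ge> 1" for \<alpha>
    using assms(3,4)[OF that] by measurable
  have law: "distr (M \<alpha>) borel (?Z \<alpha>) = density lborel (\<lambda>p. ennreal (scaled_density \<alpha> p))" if "\<alpha> \<ge> 1" for \<alpha>
  proof -
    have "distr (M \<alpha>) borel (?Z \<alpha>) = distr (distr (M \<alpha>) borel (\<lambda>\<omega>. (X \<alpha> \<omega>, Y \<alpha> \<omega>))) borel (?T \<alpha>)"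
      by (subst distr_distr[OF T pair[OF that]]) (simp add: o_def)
    then show ?thesis by (simp only: assms(5)[OF that] distr_permuton_of[OF that])
  qed
  have prob: "prob_space (distr (M \<alpha>) borel (?Z \<alpha>))" if "\<alpha> \<ge> 1" for \<alpha>
    using measurable_compose[OF pair[OF that] T]
    by (intro prob_space.prob_space_distr[OF assms(2)[OF that]]) simp
  have limit: "distr N borel ?W = density lborel (\<lambda>p. ennreal (limit_density p))"
    by (rule distr_scaled_by_inverse[OF assms(6-10)])
  \<comment> \<open>The total mass 1 of the limit density is inherited from the random vector whose
    law it describes; no integral is computed.\<close>
  have prob_limit: "prob_space (density lborel (\<lambda>p. ennreal (limit_density p)))"
    unfolding limit[symmetric]
    using assms(9)
    by (intro prob_space.prob_space_distr[OF assms(6)] borel_measurable_Pair borel_measurable_scaled_by_inverse assms(7))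
      (simp_all add: distributed_def)
  show ?thesis
    unfolding weakly_converges_def
  proof (intro allI impI)
    fix f :: "real \<times> real \<Rightarrow> real" assume f: "continuous_on UNIV f \<and> bounded (range f)"
    then obtain B where B: "\<And>p. \<bar>f p\<bar> \<le> B" by (auto simp: bounded_iff)
    \<comment> \<open>\<open>Scheffe_density_tendsto\<close> asks for a probability density at every
      real index, whereas the family is controlled for \<alpha> \<ge> 1. Clamping the index leaves
      the limit at infinity unchanged.\<close>
    have "((\<lambda>\<alpha>. integral\<^sup>L (density lborel (\<lambda>p. ennreal (scaled_density (max 1 \<alpha>) p))) f) \<longlongrightarrow>
        integral\<^sup>L (density lborel (\<lambda>p. ennreal (limit_density p))) f) at_top"
    proof (rule Scheffe_density_tendsto[OF _ _ _ _ _ _ _ _ B])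
      show "AE p in lborel. ((\<lambda>\<alpha>. scaled_density (max 1 \<alpha>) p) \<longlongrightarrow> limit_density p) at_top"
        using scaled_density_tendsto_AE
      proof eventually_elim
        case (elim p)
        have "\<forall>\<^sub>F \<alpha> in at_top. scaled_density \<alpha> p = scaled_density (max 1 \<alpha>) p"
          using eventually_ge_1 by eventually_elim (simp add: max_def)
        then show ?case by (rule Lim_transform_eventually[OF elim])
      qed
      show "prob_space (density lborel (\<lambda>p. ennreal (scaled_density (max 1 \<alpha>) p)))" for \<alpha>
        using prob[of "max 1 \<alpha>"] law[of "max 1 \<alpha>"] by simp
    qed (use f borel_measurable_scaled_density borel_measurable_limit_density scaled_density_nonneg
        limit_density_nonneg prob_limit in \<open>auto intro: borel_measurable_continuous_onI\<close>)
    moreover have "\<forall>\<^sub>F \<alpha> in at_top. integral\<^sup>L (density lborel (\<lambda>p. ennreal (scaled_density (max 1 \<alpha>) p))) f =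
        integral\<^sup>L (distr (M \<alpha>) borel (?Z \<alpha>)) f"
      using eventually_ge_1 by eventually_elim (simp only: law max.absorb2)
    ultimately show "((\<lambda>\<alpha>. integral\<^sup>L (distr (M \<alpha>) borel (?Z \<alpha>)) f) \<longlongrightarrow> integral\<^sup>L (distr N borel ?W) f) at_top"
      unfolding limit by (rule Lim_transform_eventually)
  qed
qed

end
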